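(* Let $(x_i,y_{N_2})\in\Gamma_4$ be a grid point on the side $\Gamma_4=(l_1,l_2)\times\{l_4\}$, with boundary condition $\mathcal{B}_4u=\frac{\partial u}{\partial\vec n}+\beta u=g_4$ on $\Gamma_4$, where $\beta=\beta(x)$ is smooth; take $(x_i,y_{N_2})$ as base point. Let $$C^{\mathcal{B}_4}_{k,\ell}(h)=\sum_{i=0}^{6}c^{\mathcal{B}_4}_{k,\ell,i}h^i,\qquad k\in\{-1,0,1\},\ \ell\in\{-1,0\},$$ be any non-trivial solution of the linear system induced by $$\sum_{k=-1}^1\sum_{\ell=-1}^0C^{\mathcal{B}_4}_{k,\ell}(h)\Big(G^H_{5,n,0}(kh,\ell h)-\sum_{i=n}^5\binom{i}{n}\beta^{(i-n)}G^H_{5,i,1}(kh,\ell h)(1-\delta_{n,6})\Big)=\mathcal{O}(h^7),\quad n=0,1,\dots,6,$$ where $\delta_{a,b}=1$ if $a=b$ and $0$ otherwise. Put $$C^{\mathcal{B}_4}_{f,m,n}:=\sum_{k=-1}^1\sum_{\ell=-1}^0C^{\mathcal{B}_4}_{k,\ell}Q^H_{5,m,n}(kh,\ell h),\ (m,n)\in\Lambda_4,\qquad C^{\mathcal{B}_4}_{g_4,n}:=\sum_{k=-1}^1\sum_{\ell=-1}^0C^{\mathcal{B}_4}_{k,\ell}G^H_{5,n,1}(kh,\ell h),\ n=0,\dots,5.$$ Then the 6-point scheme $$\sum_{k=-1}^1\sum_{\ell=-1}^0C^{\mathcal{B}_4}_{k,\ell}(u_h)_{i+k,N_2+\ell}=\sum_{(m,n)\in\Lambda_4}f^{(m,n)}C^{\mathcal{B}_4}_{f,m,n}+\sum_{n=0}^5g_4^{(n)}C^{\mathcal{B}_4}_{g_4,n}$$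 achieves sixth order of accuracy for $\mathcal{B}_4u=\frac{\partial u}{\partial\vec n}+\beta u=g_4$ at $(x_i,y_{N_2})$. Moreover, the maximum accuracy order of a 6-point finite difference scheme for $\mathcal{B}_4u=\frac{\partial u}{\partial\vec n}+\beta u=g_4$ at $(x_i,y_{N_2})\in\Gamma_4$ with two smooth functions $\beta(x)$ and $a(x,y)$ is six.
   Context: **Grid and problem.** $\Omega=(l_1,l_2)\times(l_3,l_4)$ with uniform grid $x_i=l_1+ih$ ($0\le i\le N_1$), $y_j=l_3+jh$ ($0\le j\le N_2$), $y_{N_2}=l_4$. The function $u$ solves $-\nabla\cdot(a\nabla u)=f$ (away from an interface in the interior across which $a$ may jump). Near the boundary point considered, $a$ is positive and smooth and $u,f$ are smooth up to the boundary. $\vec n$ is the outward normal, so on $\Gamma_4$ the condition reads $u_y+\beta u=g_4$. $(u_h)_{i,j}$ is the numerical approximation of $u(x_i,y_j)$. The analysis is local at the fixed base point as $h\to0^+$. **Notation.** $a^{(m,n)},u^{(m,n)},f^{(m,n)}$ denote $\partial_x^m\partial_y^n$ of $a,u,f$ at the base point $(x_i,y_{N_2})$; $\beta^{(n)},g_4^{(n)}$ denote $n$-th derivatives in $x$ at $x_i$. For an integer $N\ge0$: $\Lambda_N=\{(m,n)\in\mathbb{N}_0^2: m+n\le N\}$, $\Lambda_N^{H,1}=\{(m,n)\in\Lambda_N: n\in\{0,1\}\}$, $\Lambda_N^{H,2}=\Lambda_N\setminus\Lambda_N^{H,1}$. **The functions $G^H_{M,m,n}$ and $Q^H_{M,m,n}$.**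 For smooth $u$ and $f=-\nabla\cdot(a\nabla u)$, solving the equation for $u_{yy}$ and differentiating repeatedly, each $u^{(m',n')}$ with $(m',n')\in\Lambda_{M+1}^{H,2}$ is written uniquely (identically in $u$) as $$u^{(m',n')}=\sum_{(m,n)\in\Lambda_{M+1}^{H,1},\,m+n\le m'+n'}A^{H,u}_{m',n',m,n}u^{(m,n)}+\sum_{(m,n)\in\Lambda_{M-1},\,m+n\le m'+n'-2}A^{H,f}_{m',n',m,n}f^{(m,n)},$$ with constants determined by $\{a^{(m,n)}:(m,n)\in\Lambda_M\}$. Then for $(m,n)\in\Lambda_{M+1}^{H,1}$, $$G^H_{M,m,n}(x,y)=\sum_{\ell=0}^{\lfloor m/2\rfloor}\frac{(-1)^\ell y^{n+2\ell}x^{m-2\ell}}{(n+2\ell)!(m-2\ell)!}+\sum_{(m',n')\in\Lambda_{M+1}^{H,2},\,m'+n'>m+n}A^{H,u}_{m',n',m,n}\frac{x^{m'}y^{n'}}{m'!n'!},$$ and for $(m,n)\in\Lambda_{M-1}$, $$Q^H_{M,m,n}(x,y)=\frac1{a^{(0,0)}}\sum_{\ell=1}^{1+\lfloor m/2\rfloor}\frac{(-1)^\ell y^{n+2\ell}x^{m-2\ell+2}}{(n+2\ell)!(m-2\ell+2)!}+\sum_{(m',n')\in\Lambda_{M+1}^{H,2},\,m'+n'>m+n+2}A^{H,f}_{m',n',m,n}\frac{x^{m'}y^{n'}}{m'!n'!}.$$ **Non-trivial and accuracy order.** A family $\{C_{k,\ell}(h)\}$ is non-trivial if $C_{k,\ell}(0)\ne0$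 for at least one $(k,\ell)$. A 6-point scheme at $(x_i,y_{N_2})$ is given by non-trivial polynomials $C_{k,\ell}(h)$, $k\in\{-1,0,1\}$, $\ell\in\{-1,0\}$, and a right-hand side that is a finite linear combination of the $f^{(m,n)}$ and $g_4^{(n)}$ with coefficients depending only on $a,\beta,h$. It has accuracy order $p$ if, for every smooth $u$ near the point, with $f:=-\nabla\cdot(a\nabla u)$ and $g_4:=(u_y+\beta u)|_{\Gamma_4}$, the difference between $\sum_{k,\ell}C_{k,\ell}(h)u(x_i+kh,y_{N_2}+\ell h)$ and the right-hand side is $\mathcal{O}(h^{p+1})$ as $h\to0$ (i.e. $\mathcal{O}(h^p)$ after division by $h$). That the maximum accuracy order is six means that six is the largest $p$ such that for every smooth $\beta$ and every positive smooth $a$ there is a 6-point scheme of accuracy order $p$. *)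

theory Defs
  imports
    "HOL-Analysis.Analysis"
    "HOL-Computational_Algebra.Polynomial"
    "HOL-Library.Landau_Symbols"
begin

(* The domain lies below the boundary line y = y0, so on that line the y-derivative is the
   one-sided derivative from within {..y0}.  At points with y < y0 it is the ordinary one. *)

definition ddx :: "(real \<Rightarrow> real \<Rightarrow> real) \<Rightarrow> real \<Rightarrow> real \<Rightarrow> real" where
  "ddx w = (\<lambda>x y. deriv (\<lambda>s. w s y) x)"

definition ddy :: "real \<Rightarrow> (real \<Rightarrow> real \<Rightarrow> real) \<Rightarrow> real \<Rightarrow> real \<Rightarrow> real" where
  "ddy y0 w = (\<lambda>x y. vector_derivative (\<lambda>t. w x t) (at y within {..y0}))"

definition pd :: "real \<Rightarrow> nat \<Rightarrow> nat \<Rightarrow> (real \<Rightarrow> real \<Rightarrow> real) \<Rightarrow> real \<Rightarrow> real \<Rightarrow> real" where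
  "pd y0 m n w = (ddx ^^ m) ((ddy y0 ^^ n) w)"

definition half_nbhd :: "real \<Rightarrow> real \<Rightarrow> real \<Rightarrow> (real \<times> real) set" where
  "half_nbhd x0 y0 r = {x0 - r<..<x0 + r} \<times> {y0 - r<..y0}"

(* Smoothness up to the boundary near (x0, y0).  By Schwarz's theorem the remaining mixed
   derivatives, taken in any other order, then exist and agree with those below. *)

definition smooth_upto :: "real \<Rightarrow> real \<Rightarrow> (real \<Rightarrow> real \<Rightarrow> real) \<Rightarrow> bool" where
  "smooth_upto x0 y0 w \<longleftrightarrow> (\<exists>r>0. \<forall>m n.
     (\<forall>(x, y) \<in> half_nbhd x0 y0 r.
        (\<lambda>s. pd y0 m n w s y) differentiable (at x) \<and>
        (\<lambda>t. pd y0 m n w x t) differentiable (at y within {..y0})) \<and>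
     continuous_on (half_nbhd x0 y0 r) (\<lambda>(x, y). pd y0 m n w x y))"

definition positive_near :: "real \<Rightarrow> real \<Rightarrow> (real \<Rightarrow> real \<Rightarrow> real) \<Rightarrow> bool" where
  "positive_near x0 y0 w \<longleftrightarrow> (\<exists>r>0. \<forall>(x, y) \<in> half_nbhd x0 y0 r. w x y > 0)"

definition smooth_at :: "real \<Rightarrow> (real \<Rightarrow> real) \<Rightarrow> bool" where
  "smooth_at x0 b \<longleftrightarrow>
     (\<exists>r>0. \<forall>n. \<forall>x \<in> {x0 - r<..<x0 + r}. (deriv ^^ n) b differentiable (at x))"

(* -div (a grad u) *)

definition source :: "real \<Rightarrow> (real \<Rightarrow> real \<Rightarrow> real) \<Rightarrow> (real \<Rightarrow> real \<Rightarrow> real) \<Rightarrow> real \<Rightarrow> real \<Rightarrow> real" where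
  "source y0 a u = (\<lambda>x y.
     - (ddx (\<lambda>x y. a x y * ddx u x y) x y + ddy y0 (\<lambda>x y. a x y * ddy y0 u x y) x y))"

(* du/dn + beta u on the line y = y0, with outward normal (0, 1) *)

definition boundary_data :: "real \<Rightarrow> (real \<Rightarrow> real) \<Rightarrow> (real \<Rightarrow> real \<Rightarrow> real) \<Rightarrow> real \<Rightarrow> real" where
  "boundary_data y0 b u = (\<lambda>x. ddy y0 u x y0 + b x * u x y0)"

definition Lam :: "nat \<Rightarrow> (nat \<times> nat) set" where
  "Lam N = {(m, n). m + n \<le> N}"

definition LamH1 :: "nat \<Rightarrow> (nat \<times> nat) set" where
  "LamH1 N = {(m, n) \<in> Lam N. n \<in> {0, 1}}"

definition LamH2 :: "nat \<Rightarrow> (nat \<times> nat) set" where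
  "LamH2 N = Lam N - LamH1 N"

(* Elimination of the jets in LamH2 via the equation, identically in u.
   Here m + n + 2 \<le> m' + n' is the condition m + n \<le> m' + n' - 2 without truncation. *)

definition is_reduction ::
  "real \<Rightarrow> real \<Rightarrow> (real \<Rightarrow> real \<Rightarrow> real) \<Rightarrow> nat \<Rightarrow>
   (nat \<Rightarrow> nat \<Rightarrow> nat \<Rightarrow> nat \<Rightarrow> real) \<Rightarrow> (nat \<Rightarrow> nat \<Rightarrow> nat \<Rightarrow> nat \<Rightarrow> real) \<Rightarrow> bool" where
  "is_reduction x0 y0 a M Au Af \<longleftrightarrow>
     (\<forall>u. smooth_upto x0 y0 u \<longrightarrow>
       (\<forall>(m', n') \<in> LamH2 (M + 1).
         pd y0 m' n' u x0 y0 =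
           (\<Sum>(m, n) \<in> {(m, n) \<in> LamH1 (M + 1). m + n \<le> m' + n'}.
              Au m' n' m n * pd y0 m n u x0 y0) +
           (\<Sum>(m, n) \<in> {(m, n) \<in> Lam (M - 1). m + n + 2 \<le> m' + n'}.
              Af m' n' m n * pd y0 m n (source y0 a u) x0 y0)))"

(* The identity determines Au and Af uniquely at all index pairs occurring in it, and GH and QH
   below use only such pairs; the choice is arbitrary only at irrelevant index pairs. *)

definition reduction ::
  "real \<Rightarrow> real \<Rightarrow> (real \<Rightarrow> real \<Rightarrow> real) \<Rightarrow> nat \<Rightarrow>
   (nat \<Rightarrow> nat \<Rightarrow> nat \<Rightarrow> nat \<Rightarrow> real) \<times> (nat \<Rightarrow> nat \<Rightarrow> nat \<Rightarrow> nat \<Rightarrow> real)" where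
  "reduction x0 y0 a M = (SOME (Au, Af). is_reduction x0 y0 a M Au Af)"

definition AHu ::
  "real \<Rightarrow> real \<Rightarrow> (real \<Rightarrow> real \<Rightarrow> real) \<Rightarrow> nat \<Rightarrow> nat \<Rightarrow> nat \<Rightarrow> nat \<Rightarrow> nat \<Rightarrow> real" where
  "AHu x0 y0 a M = fst (reduction x0 y0 a M)"

definition AHf ::
  "real \<Rightarrow> real \<Rightarrow> (real \<Rightarrow> real \<Rightarrow> real) \<Rightarrow> nat \<Rightarrow> nat \<Rightarrow> nat \<Rightarrow> nat \<Rightarrow> nat \<Rightarrow> real" where
  "AHf x0 y0 a M = snd (reduction x0 y0 a M)"

definition GH ::
  "real \<Rightarrow> real \<Rightarrow> (real \<Rightarrow> real \<Rightarrow> real) \<Rightarrow> nat \<Rightarrow> nat \<Rightarrow> nat \<Rightarrow> real \<Rightarrow> real \<Rightarrow> real" where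
  "GH x0 y0 a M m n x y =
     (\<Sum>l = 0..m div 2.
        (-1) ^ l * y ^ (n + 2 * l) * x ^ (m - 2 * l) / (fact (n + 2 * l) * fact (m - 2 * l))) +
     (\<Sum>(m', n') \<in> {(m', n') \<in> LamH2 (M + 1). m' + n' > m + n}.
        AHu x0 y0 a M m' n' m n * (x ^ m' * y ^ n' / (fact m' * fact n')))"

(* m + 2 - 2 * l is m - 2 l + 2, which is never negative for l \<le> 1 + m div 2. *)

definition QH ::
  "real \<Rightarrow> real \<Rightarrow> (real \<Rightarrow> real \<Rightarrow> real) \<Rightarrow> nat \<Rightarrow> nat \<Rightarrow> nat \<Rightarrow> real \<Rightarrow> real \<Rightarrow> real" where
  "QH x0 y0 a M m n x y =
     1 / a x0 y0 *
     (\<Sum>l = 1..1 + m div 2.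
        (-1) ^ l * y ^ (n + 2 * l) * x ^ (m + 2 - 2 * l)
          / (fact (n + 2 * l) * fact (m + 2 - 2 * l))) +
     (\<Sum>(m', n') \<in> {(m', n') \<in> LamH2 (M + 1). m' + n' > m + n + 2}.
        AHf x0 y0 a M m' n' m n * (x ^ m' * y ^ n' / (fact m' * fact n')))"

(* Stencil coefficients are polynomials in h; only k in {-1..1} and l in {-1..0} matter. *)

definition nontrivial :: "(int \<Rightarrow> int \<Rightarrow> real poly) \<Rightarrow> bool" where
  "nontrivial C \<longleftrightarrow> (\<exists>k\<in>{-1..1}. \<exists>l\<in>{-1..0}. poly (C k l) 0 \<noteq> 0)"

definition stencil_sum ::
  "(int \<Rightarrow> int \<Rightarrow> real poly) \<Rightarrow> (real \<Rightarrow> real \<Rightarrow> real) \<Rightarrow> real \<Rightarrow> real" where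
  "stencil_sum C w h =
     (\<Sum>k\<in>{-1..1}. \<Sum>l\<in>{-1..0}. poly (C k l) h * w (of_int k * h) (of_int l * h))"

(* A 6-point scheme: stencil polynomials C, and a right-hand side using the f^(m,n) with
   (m,n) in F and the g^(n) with n in K, with coefficients Cf m n h and Cg n h. *)

definition has_accuracy_order ::
  "real \<Rightarrow> real \<Rightarrow> (real \<Rightarrow> real \<Rightarrow> real) \<Rightarrow> (real \<Rightarrow> real) \<Rightarrow> (int \<Rightarrow> int \<Rightarrow> real poly) \<Rightarrow>
   (nat \<times> nat) set \<Rightarrow> (nat \<Rightarrow> nat \<Rightarrow> real \<Rightarrow> real) \<Rightarrow> nat set \<Rightarrow> (nat \<Rightarrow> real \<Rightarrow> real) \<Rightarrow> nat \<Rightarrow> bool"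
where
  "has_accuracy_order x0 y0 a b C F Cf K Cg p \<longleftrightarrow>
     nontrivial C \<and> finite F \<and> finite K \<and>
     (\<forall>u. smooth_upto x0 y0 u \<longrightarrow>
        (\<lambda>h. stencil_sum C (\<lambda>x y. u (x0 + x) (y0 + y)) h
              - ((\<Sum>(m, n)\<in>F. pd y0 m n (source y0 a u) x0 y0 * Cf m n h) +
                 (\<Sum>n\<in>K. (deriv ^^ n) (boundary_data y0 b u) x0 * Cg n h)))
          \<in> O[at_right 0](\<lambda>h. h ^ (p + 1)))"

definition attainable_order :: "real \<Rightarrow> real \<Rightarrow> nat \<Rightarrow> bool" where
  "attainable_order x0 y0 p \<longleftrightarrow>
     (\<forall>a b. smooth_upto x0 y0 a \<and> positive_near x0 y0 a \<and> smooth_at x0 b \<longrightarrow>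
        (\<exists>C F Cf K Cg. has_accuracy_order x0 y0 a b C F Cf K Cg p))"

definition max_accuracy_order :: "real \<Rightarrow> real \<Rightarrow> nat \<Rightarrow> bool" where
  "max_accuracy_order x0 y0 p \<longleftrightarrow>
     attainable_order x0 y0 p \<and> (\<forall>q. attainable_order x0 y0 q \<longrightarrow> q \<le> p)"

end

theory Submission
  imports Defs
begin

text \<open>
The equation determines every derivative \<open>u^(p,q)\<close> with \<open>q \<ge> 2\<close> at the base point from the Cauchy jet, that is from
the derivatives with \<open>q \<le> 1\<close>, and from derivatives of \<open>f\<close> (\<open>reducible_jet\<close>).  Substituting this into the
Taylor polynomial of \<open>u\<close> and collecting terms produces exactly the functions \<open>G\<close> and \<open>Q\<close> as
coefficients (\<open>taylor_polynomial_GH_QH\<close>).  The boundary condition, differentiated along the boundary,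
expresses \<open>u^(m,1)\<close> by \<open>g\<close> and tangential derivatives, which leaves only the \<open>u^(n,0)\<close>; their
coefficients (\<open>boundary_kernel\<close>) are the functions in the linear system.  Applied to \<open>u\<close>, the stencil therefore
gives the right-hand side of the scheme, a combination of the residuals of the system, and the stencil
applied to the Taylor remainder.  The last two are \<open>O(h^7)\<close> (\<open>scheme_accuracy\<close>).

For the existence of a sixth order scheme the system is solved power by power in \<open>h\<close>.  The lowest part of the
\<open>n\<close>-th kernel is \<open>Re (x + i y)^n / n!\<close>, whatever \<open>a\<close> and \<open>\<beta>\<close> are, so the coefficient of \<open>h^s\<close> in the stencil has
to solve an interpolation problem at six points for the harmonic polynomials with \<open>n \<le> 6 - s\<close>.  For \<open>s = 0\<close> the
compact stencil with weights \<open>-10, 2, 4, 1\<close> solves the homogeneous problem.  For \<open>s \<ge> 1\<close> there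
is a single solvability condition, linking \<open>n = 1, 3, 5\<close>: three functions that are odd in \<open>x\<close> meet two odd
stencil weights (\<open>harmonic_interpolation\<close>).  Only \<open>s = 1\<close> includes \<open>n = 5\<close>, and there the condition can be checked
because the next part of the kernel is known explicitly (\<open>boundary_coef_subleading\<close>).

Order seven already fails for \<open>a = 1\<close> and \<open>\<beta> = 1\<close> (\<open>accuracy_order_le_six\<close>).  The polynomials
\<open>Re z^n / n! - Im z^(n+1) / (n + 1)!\<close> have \<open>f = 0\<close> and \<open>g = 0\<close>, so they test the stencil alone, for arbitrary
right-hand sides.  They force the leading weights to be \<open>t\<close> times the compact stencil, and the weights of \<open>h^1\<close> to
pair to \<open>0\<close> with \<open>Re z^2\<close> but to \<open>20 t / 7\<close> with \<open>Re z^6\<close>.  Since \<open>Re z^2\<close> and \<open>Re z^6\<close> agree at all six points, \<open>t = 0\<close>.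
\<close>

section \<open>One-sided calculus up to the boundary\<close>

text \<open>
A consistent system of all partial derivatives of \<open>D 0 0\<close>.  Unlike iterated derivative operators, such a
system is closed under sums, products and shifts, and it does not fix an order of
differentiation.
\<close>

definition deriv_family ::
  "real \<Rightarrow> real \<Rightarrow> real \<Rightarrow> (nat \<Rightarrow> nat \<Rightarrow> real \<Rightarrow> real \<Rightarrow> real) \<Rightarrow> bool" where
  "deriv_family x0 y0 r D \<longleftrightarrow> (\<forall>m n.
     (\<forall>x y. (x, y) \<in> half_nbhd x0 y0 r \<longrightarrow>
        ((\<lambda>s. D m n s y) has_real_derivative D (Suc m) n x y) (at x) \<and>
        ((\<lambda>t. D m n x t) has_real_derivative D m (Suc n) x y) (at y within {..y0})) \<and>
     continuous_on (half_nbhd x0 y0 r) (\<lambda>(x, y). D m n x y))"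

lemma deriv_familyD:
  assumes "deriv_family x0 y0 r D"
  shows "(x, y) \<in> half_nbhd x0 y0 r \<Longrightarrow>
      ((\<lambda>s. D m n s y) has_real_derivative D (Suc m) n x y) (at x)"
    and "(x, y) \<in> half_nbhd x0 y0 r \<Longrightarrow>
      ((\<lambda>t. D m n x t) has_real_derivative D m (Suc n) x y) (at y within {..y0})"
    and "continuous_on (half_nbhd x0 y0 r) (\<lambda>(x, y). D m n x y)"
  using assms unfolding deriv_family_def by blast+

lemma half_nbhd_base: "r > 0 \<Longrightarrow> (x0, y0) \<in> half_nbhd x0 y0 r"
  by (simp add: half_nbhd_def)

lemma half_nbhd_mono: "r \<le> r' \<Longrightarrow> half_nbhd x0 y0 r \<subseteq> half_nbhd x0 y0 r'"
  by (auto simp: half_nbhd_def)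

lemma deriv_family_mono:
  assumes "deriv_family x0 y0 r' D" "r \<le> r'"
  shows "deriv_family x0 y0 r D"
  using assms half_nbhd_mono[OF assms(2), of x0 y0]
  unfolding deriv_family_def by (meson continuous_on_subset subsetD)

lemma eventually_half_nbhd_x:
  assumes "(x, y) \<in> half_nbhd x0 y0 r"
  shows "eventually (\<lambda>s. (s, y) \<in> half_nbhd x0 y0 r) (nhds x)"
proof -
  have "eventually (\<lambda>s. s \<in> {x0 - r<..<x0 + r}) (nhds x)"
    using assms by (intro eventually_nhds_in_open) (auto simp: half_nbhd_def)
  then show ?thesis
    by eventually_elim (use assms in \<open>auto simp: half_nbhd_def\<close>)
qed

lemma eventually_half_nbhd_y:
  assumes "(x, y) \<in> half_nbhd x0 y0 r"
  shows "eventually (\<lambda>t. (x, t) \<in> half_nbhd x0 y0 r) (at y within {..y0})"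
proof -
  have "eventually (\<lambda>t. t \<in> {y0 - r<..}) (nhds y)"
    using assms by (intro eventually_nhds_in_open) (auto simp: half_nbhd_def)
  then have "eventually (\<lambda>t. t \<in> {y0 - r<..}) (at y within {..y0})"
    by (rule filter_leD[OF at_within_le_nhds])
  moreover have "eventually (\<lambda>t. t \<in> {..y0}) (at y within {..y0})"
    by (simp add: eventually_at_filter)
  ultimately show ?thesis
    by eventually_elim (use assms in \<open>auto simp: half_nbhd_def\<close>)
qed

lemma at_within_atMost_neq_bot:
  fixes y y0 :: real
  assumes "y \<le> y0" shows "at y within {..y0} \<noteq> bot"
proof -
  have "at_left y \<le> at y within {..y0}"
    using assms by (intro at_le) auto
  then show ?thesis
    using trivial_limit_at_left_real[of y] by (auto simp: trivial_limit_def le_filter_def)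
qed

lemma ddx_eq_on:
  assumes "\<And>x y. (x, y) \<in> half_nbhd x0 y0 r \<Longrightarrow> w x y = v x y"
    and "(x, y) \<in> half_nbhd x0 y0 r"
    and "((\<lambda>s. v s y) has_real_derivative d) (at x)"
  shows "((\<lambda>s. w s y) has_real_derivative d) (at x)" "ddx w x y = d"
proof -
  have "eventually (\<lambda>s. w s y = v s y) (at x)"
    using eventually_half_nbhd_x[OF assms(2)] assms(1)
    by (auto simp: eventually_at_filter elim: eventually_mono)
  then show "((\<lambda>s. w s y) has_real_derivative d) (at x)"
    using has_field_derivative_cong_eventually[of "\<lambda>s. w s y" "\<lambda>s. v s y" x UNIV] assms by auto
  then show "ddx w x y = d"
    unfolding ddx_def by (rule DERIV_imp_deriv)
qed

lemma ddy_eq_on: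
  assumes "\<And>x y. (x, y) \<in> half_nbhd x0 y0 r \<Longrightarrow> w x y = v x y"
    and "(x, y) \<in> half_nbhd x0 y0 r"
    and "((\<lambda>t. v x t) has_real_derivative d) (at y within {..y0})"
  shows "((\<lambda>t. w x t) has_real_derivative d) (at y within {..y0})" "ddy y0 w x y = d"
proof -
  have "eventually (\<lambda>t. w x t = v x t) (at y within {..y0})"
    using eventually_half_nbhd_y[OF assms(2)] assms(1) by (auto elim: eventually_mono)
  then show *: "((\<lambda>t. w x t) has_real_derivative d) (at y within {..y0})"
    using has_field_derivative_cong_eventually[of "\<lambda>t. w x t" "\<lambda>t. v x t" y "{..y0}"] assms by auto
  have "y \<le> y0" using assms(2) by (auto simp: half_nbhd_def)
  with * show "ddy y0 w x y = d"
    unfolding ddy_def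
    by (intro vector_derivative_within at_within_atMost_neq_bot)
       (auto simp: has_real_derivative_iff_has_vector_derivative)
qed

text \<open>
The set \<open>half_nbhd\<close> is open in the \<open>x\<close>-direction and relatively open in \<open>{..y0}\<close> in the \<open>y\<close>-direction, so
derivatives there only see values in the set, and each derivative operator can be
replaced by the corresponding shift of the family.
\<close>

lemma pd_deriv_family:
  assumes D: "deriv_family x0 y0 r D"
    and w: "\<And>x y. (x, y) \<in> half_nbhd x0 y0 r \<Longrightarrow> w x y = D 0 0 x y"
    and "(x, y) \<in> half_nbhd x0 y0 r"
  shows "pd y0 m n w x y = D m n x y"
proof -
  have y: "(ddy y0 ^^ n) w x y = D 0 n x y" if "(x, y) \<in> half_nbhd x0 y0 r" for n x y
    using that
  proof (induction n arbitrary: x y)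
    case 0 then show ?case by (simp add: w)
  next
    case (Suc n)
    show ?case
      using ddy_eq_on(2)[where w = "(ddy y0 ^^ n) w" and v = "D 0 n",
          OF Suc.IH Suc.prems deriv_familyD(2)[OF D Suc.prems]] by simp
  qed
  show ?thesis using assms(3)
  proof (induction m arbitrary: x y)
    case 0 then show ?case by (simp add: pd_def y)
  next
    case (Suc m)
    have "ddx (pd y0 m n w) x y = D (Suc m) n x y"
      using ddx_eq_on(2)[where w = "pd y0 m n w" and v = "D m n",
          OF Suc.IH Suc.prems deriv_familyD(1)[OF D Suc.prems]] .
    then show ?case by (simp add: pd_def)
  qed
qed

lemma smooth_upto_deriv_familyI:
  assumes D: "deriv_family x0 y0 r D" and "r > 0"
    and w: "\<And>x y. (x, y) \<in> half_nbhd x0 y0 r \<Longrightarrow> w x y = D 0 0 x y"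
  shows "smooth_upto x0 y0 w"
  unfolding smooth_upto_def
proof (intro exI[of _ r] conjI allI)
  note pd = pd_deriv_family[OF D w]
  fix m n
  show "\<forall>(x, y)\<in>half_nbhd x0 y0 r. (\<lambda>s. pd y0 m n w s y) differentiable at x \<and>
      (\<lambda>t. pd y0 m n w x t) differentiable at y within {..y0}"
  proof clarify
    fix x y assume xy: "(x, y) \<in> half_nbhd x0 y0 r"
    show "(\<lambda>s. pd y0 m n w s y) differentiable at x \<and>
      (\<lambda>t. pd y0 m n w x t) differentiable at y within {..y0}"
      using ddx_eq_on(1)[where w = "pd y0 m n w" and v = "D m n",
          OF pd xy deriv_familyD(1)[OF D xy]]
        ddy_eq_on(1)[where w = "pd y0 m n w" and v = "D m n",
          OF pd xy deriv_familyD(2)[OF D xy]]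
      by (auto simp: real_differentiable_def)
  qed
  show "continuous_on (half_nbhd x0 y0 r) (\<lambda>(x, y). pd y0 m n w x y)"
    using deriv_familyD(3)[OF D, of m n] pd
    by (subst continuous_on_cong[OF refl, of _ _ "\<lambda>(x, y). D m n x y"]) auto
qed fact

text \<open>
Schwarz's theorem up to the boundary.  The second difference of \<open>v\<close> over a small rectangle with one corner at
\<open>(x, y)\<close> is close to \<open>vyx x y\<close> times the area, by a mean value bound in each variable, uniformly in the
width of the rectangle.  Letting the width tend to \<open>0\<close> turns the horizontal
differences into \<open>vx\<close> without assuming anything about the \<open>y\<close>-derivative of \<open>vx\<close>.
\<close>

lemma mixed_derivatives_commute:
  fixes v :: "real \<Rightarrow> real \<Rightarrow> real"
  assumes vx: "\<And>x y. (x, y) \<in> half_nbhd x0 y0 r \<Longrightarrow>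
      ((\<lambda>s. v s y) has_real_derivative vx x y) (at x)"
    and vy: "\<And>x y. (x, y) \<in> half_nbhd x0 y0 r \<Longrightarrow>
      ((\<lambda>t. v x t) has_real_derivative vy x y) (at y within {..y0})"
    and vyx: "\<And>x y. (x, y) \<in> half_nbhd x0 y0 r \<Longrightarrow>
      ((\<lambda>s. vy s y) has_real_derivative vyx x y) (at x)"
    and cont: "continuous_on (half_nbhd x0 y0 r) (\<lambda>(x, y). vyx x y)"
    and xy: "(x, y) \<in> half_nbhd x0 y0 r"
  shows "((\<lambda>t. vx x t) has_real_derivative vyx x y) (at y within {..y0})"
proof -
  let ?U = "half_nbhd x0 y0 r"
  let ?L = "vyx x y"
  have main: "\<exists>d>0. \<forall>t\<in>{..y0}. \<bar>t - y\<bar> < d \<longrightarrow> \<bar>vx x t - vx x y - ?L * (t - y)\<bar> \<le> e * \<bar>t - y\<bar>"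
    if "e > 0" for e
  proof -
    obtain d0 where d0: "d0 > 0"
      "\<And>p. p \<in> ?U \<Longrightarrow> dist p (x, y) < d0 \<Longrightarrow> \<bar>vyx (fst p) (snd p) - ?L\<bar> < e"
      using cont xy \<open>e > 0\<close> unfolding continuous_on_iff
      by (force simp: case_prod_beta dist_real_def)
    define d where "d = min (d0 / 2) (min (r - \<bar>x - x0\<bar>) (y - (y0 - r)))"
    have d: "d > 0" "d \<le> d0 / 2" "d \<le> r - \<bar>x - x0\<bar>" "d \<le> y - (y0 - r)"
      using d0(1) xy unfolding d_def half_nbhd_def by (auto simp: min_def)
    have near: "(s, t) \<in> ?U \<and> \<bar>vyx s t - ?L\<bar> \<le> e"
      if "\<bar>s - x\<bar> < d" "\<bar>t - y\<bar> < d" "t \<le> y0" for s t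
    proof -
      have U: "(s, t) \<in> ?U" using that d by (auto simp: half_nbhd_def)
      have "dist (s, t) (x, y) \<le> \<bar>s - x\<bar> + \<bar>t - y\<bar>"
        unfolding dist_Pair_Pair dist_real_def
        using sqrt_sum_squares_le_sum_abs[of "\<bar>s - x\<bar>" "\<bar>t - y\<bar>"] by simp
      also have "\<dots> < d0" using that d by linarith
      finally show ?thesis using d0(2)[OF U] U by force
    qed
    have "\<bar>vx x t - vx x y - ?L * (t - y)\<bar> \<le> e * \<bar>t - y\<bar>" if t: "t \<le> y0" "\<bar>t - y\<bar> < d" for t
    proof -
      have yy0: "y \<le> y0" using xy by (auto simp: half_nbhd_def)
      \<comment> \<open>The second difference over the rectangle with corners \<open>(x, y)\<close> and \<open>(s, t)\<close> is
          compared with \<open>L (s - x) (t - y)\<close> by two applications of the mean value bound.\<close>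
      have rect: "\<bar>(v s t - v x t) - (v s y - v x y) - ?L * (s - x) * (t - y)\<bar>
          \<le> e * \<bar>s - x\<bar> * \<bar>t - y\<bar>" if s: "\<bar>s - x\<bar> < d" for s
      proof -
        define T where "T = closed_segment y t"
        have T: "\<bar>\<tau> - y\<bar> < d \<and> \<tau> \<le> y0" if "\<tau> \<in> T" for \<tau>
          using that t yy0 unfolding T_def closed_segment_eq_real_ivl by (auto split: if_splits)
        have inner: "\<bar>vy s \<tau> - vy x \<tau> - ?L * (s - x)\<bar> \<le> e * \<bar>s - x\<bar>" if "\<tau> \<in> T" for \<tau>
        proof -
          have seg: "\<bar>\<sigma> - x\<bar> < d" if "\<sigma> \<in> closed_segment x s" for \<sigma>
            using that s unfolding closed_segment_eq_real_ivl by (auto split: if_splits)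
          have "norm ((vy s \<tau> - ?L * s) - (vy x \<tau> - ?L * x)) \<le> e * norm (s - x)"
          proof (rule field_differentiable_bound[where S = "closed_segment x s"
                and f = "\<lambda>\<sigma>. vy \<sigma> \<tau> - ?L * \<sigma>" and f' = "\<lambda>\<sigma>. vyx \<sigma> \<tau> - ?L"])
            fix \<sigma> assume \<sigma>: "\<sigma> \<in> closed_segment x s"
            have U: "(\<sigma>, \<tau>) \<in> ?U" "\<bar>vyx \<sigma> \<tau> - ?L\<bar> \<le> e"
              using near[OF seg[OF \<sigma>]] T[OF \<open>\<tau> \<in> T\<close>] by auto
            show "((\<lambda>\<sigma>. vy \<sigma> \<tau> - ?L * \<sigma>) has_field_derivative vyx \<sigma> \<tau> - ?L)
                (at \<sigma> within closed_segment x s)"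
              by (rule derivative_eq_intros has_field_derivative_at_within[OF vyx[OF U(1)]] refl
                    | simp)+
            show "norm (vyx \<sigma> \<tau> - ?L) \<le> e" using U by simp
          qed auto
          then show ?thesis by (simp add: algebra_simps)
        qed
        have "norm ((v s t - v x t - ?L * (s - x) * t) - (v s y - v x y - ?L * (s - x) * y))
            \<le> (e * \<bar>s - x\<bar>) * norm (t - y)"
        proof (rule field_differentiable_bound[where S = T
              and f = "\<lambda>\<tau>. v s \<tau> - v x \<tau> - ?L * (s - x) * \<tau>"
              and f' = "\<lambda>\<tau>. vy s \<tau> - vy x \<tau> - ?L * (s - x)"])
          fix \<tau> assume \<tau>: "\<tau> \<in> T"
          have sub: "T \<subseteq> {..y0}" using T by auto
          have "(s, \<tau>) \<in> ?U" "(x, \<tau>) \<in> ?U"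
            using near[of s \<tau>] near[of x \<tau>] T[OF \<tau>] s d(1) by auto
          note vy[OF this(1), THEN DERIV_subset, OF sub] vy[OF this(2), THEN DERIV_subset, OF sub]
          note dd = this
          show "((\<lambda>\<tau>. v s \<tau> - v x \<tau> - ?L * (s - x) * \<tau>) has_field_derivative
              vy s \<tau> - vy x \<tau> - ?L * (s - x)) (at \<tau> within T)"
            by (rule derivative_eq_intros dd refl | simp)+
          show "norm (vy s \<tau> - vy x \<tau> - ?L * (s - x)) \<le> e * \<bar>s - x\<bar>"
            using inner[OF \<tau>] by simp
        qed (auto simp: T_def)
        then show ?thesis by (simp add: algebra_simps)
      qed
      have U: "(x, t) \<in> ?U" using near[of x t] t d(1) by auto
      let ?q = "\<lambda>s. (v s t - v x t) / (s - x) - (v s y - v x y) / (s - x) - ?L * (t - y)"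
      have lim: "((\<lambda>s. \<bar>?q s\<bar>) \<longlongrightarrow> \<bar>vx x t - vx x y - ?L * (t - y)\<bar>) (at x)"
        using vx[OF U] vx[OF xy] unfolding has_field_derivative_iff
        by (intro tendsto_intros)
      have "eventually (\<lambda>s. \<bar>?q s\<bar> \<le> e * \<bar>t - y\<bar>) (at x)"
        unfolding eventually_at
      proof (intro exI[of _ d] conjI ballI impI)
        fix s assume s: "s \<noteq> x \<and> dist s x < d"
        have "?q s = ((v s t - v x t) - (v s y - v x y) - ?L * (s - x) * (t - y)) / (s - x)"
          using s by (simp add: diff_divide_distrib)
        also have "\<bar>\<dots>\<bar> \<le> e * \<bar>s - x\<bar> * \<bar>t - y\<bar> / \<bar>s - x\<bar>"
          unfolding abs_divide using rect[of s] s
          by (intro divide_right_mono) (auto simp: dist_real_def)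
        also have "\<dots> = e * \<bar>t - y\<bar>" using s by simp
        finally show "\<bar>?q s\<bar> \<le> e * \<bar>t - y\<bar>" .
      qed (use d in auto)
      with lim show ?thesis
        using tendsto_upperbound trivial_limit_at by blast
    qed
    then show ?thesis using d(1) by auto
  qed
  show ?thesis
    unfolding has_field_derivative_def has_derivative_within_alt
    using main by (simp add: bounded_linear_mult_right)
qed

text \<open>
Smoothness speaks of the derivatives \<open>ddx\<close> after \<open>ddy\<close> only; commuting them moves one further \<open>ddy\<close>
inwards past each \<open>ddx\<close>, by induction on the number of \<open>ddx\<close>.
\<close>

lemma smooth_upto_deriv_familyE:
  assumes "smooth_upto x0 y0 w"
  obtains r where "r > 0" "deriv_family x0 y0 r (\<lambda>m n. pd y0 m n w)"
proof -
  from assms obtain r where r: "r > 0" and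
    S: "\<And>m n x y. (x, y) \<in> half_nbhd x0 y0 r \<Longrightarrow> (\<lambda>s. pd y0 m n w s y) differentiable (at x)"
    "\<And>m n x y. (x, y) \<in> half_nbhd x0 y0 r \<Longrightarrow>
        (\<lambda>t. pd y0 m n w x t) differentiable (at y within {..y0})"
    and cont: "\<And>m n. continuous_on (half_nbhd x0 y0 r) (\<lambda>(x, y). pd y0 m n w x y)"
    unfolding smooth_upto_def by (force simp: split_beta)
  let ?U = "half_nbhd x0 y0 r"
  have dx: "((\<lambda>s. pd y0 m n w s y) has_real_derivative pd y0 (Suc m) n w x y) (at x)"
    if xy: "(x, y) \<in> ?U" for m n x y
  proof -
    from S(1)[OF that] obtain d where d: "((\<lambda>s. pd y0 m n w s y) has_real_derivative d) (at x)"
      by (auto simp: real_differentiable_def)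
    then have "d = pd y0 (Suc m) n w x y"
      using DERIV_imp_deriv[OF d] by (simp add: pd_def ddx_def)
    with d show ?thesis by simp
  qed
  have dy0: "((\<lambda>t. pd y0 0 n w x t) has_real_derivative pd y0 0 (Suc n) w x y) (at y within {..y0})"
    if xy: "(x, y) \<in> ?U" for n x y
  proof -
    from S(2)[OF that] obtain d where
      d: "((\<lambda>t. pd y0 0 n w x t) has_real_derivative d) (at y within {..y0})"
      by (auto simp: real_differentiable_def)
    from ddy_eq_on(2)[where w = "pd y0 0 n w" and v = "pd y0 0 n w", OF refl xy this] have "d = pd y0 0 (Suc n) w x y"
      by (simp add: pd_def)
    with d show ?thesis by simp
  qed
  have dy: "((\<lambda>t. pd y0 m n w x t) has_real_derivative pd y0 m (Suc n) w x y) (at y within {..y0})"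
    if xy: "(x, y) \<in> ?U" for m n x y
    using xy
  proof (induction m arbitrary: x y)
    case 0 then show ?case by (rule dy0)
  next
    case (Suc m)
    show ?case
      by (rule mixed_derivatives_commute[OF dx Suc.IH dx cont Suc.prems])
  qed
  have "deriv_family x0 y0 r (\<lambda>m n. pd y0 m n w)"
    unfolding deriv_family_def using dx dy cont by auto
  with r that show thesis by blast
qed

section \<open>Jets of sums, products and of the data\<close>

lemma common_deriv_family:
  assumes "smooth_upto x0 y0 v" "smooth_upto x0 y0 w"
  obtains r where "r > 0" "deriv_family x0 y0 r (\<lambda>m n. pd y0 m n v)"
    "deriv_family x0 y0 r (\<lambda>m n. pd y0 m n w)"
proof -
  from assms obtain r1 r2 where "r1 > 0" "deriv_family x0 y0 r1 (\<lambda>m n. pd y0 m n v)"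
    "r2 > 0" "deriv_family x0 y0 r2 (\<lambda>m n. pd y0 m n w)"
    by (metis smooth_upto_deriv_familyE)
  then show thesis
    by (intro that[of "min r1 r2"]) (auto intro: deriv_family_mono)
qed

lemma pd_0_0 [simp]: "pd y0 0 0 w = w"
  by (simp add: pd_def)

lemma smooth_upto_jetsI:
  assumes "r > 0" "deriv_family x0 y0 r D"
    and "\<And>x y. (x, y) \<in> half_nbhd x0 y0 r \<Longrightarrow> w x y = D 0 0 x y"
  shows "smooth_upto x0 y0 w"
    and "\<And>m n. pd y0 m n w x0 y0 = D m n x0 y0"
  using smooth_upto_deriv_familyI[OF assms(2,1,3)]
    pd_deriv_family[OF assms(2,3) half_nbhd_base[OF assms(1)]] by simp_all

lemma smooth_upto_add:
  assumes "smooth_upto x0 y0 v" "smooth_upto x0 y0 w"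
  shows "smooth_upto x0 y0 (\<lambda>x y. v x y + w x y)"
    and "\<And>m n. pd y0 m n (\<lambda>x y. v x y + w x y) x0 y0 = pd y0 m n v x0 y0 + pd y0 m n w x0 y0"
proof -
  obtain r where r: "r > 0" and v: "deriv_family x0 y0 r (\<lambda>m n. pd y0 m n v)"
    and w: "deriv_family x0 y0 r (\<lambda>m n. pd y0 m n w)"
    using common_deriv_family[OF assms] .
  have "deriv_family x0 y0 r (\<lambda>m n x y. pd y0 m n v x y + pd y0 m n w x y)"
    using deriv_familyD[OF v] deriv_familyD[OF w] unfolding deriv_family_def
    by (auto intro!: DERIV_add continuous_on_add simp: split_beta)
  from smooth_upto_jetsI[OF r this] show "smooth_upto x0 y0 (\<lambda>x y. v x y + w x y)"
    and "pd y0 m n (\<lambda>x y. v x y + w x y) x0 y0 = pd y0 m n v x0 y0 + pd y0 m n w x0 y0" for m n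
    by simp_all
qed

lemma smooth_upto_cmult:
  assumes "smooth_upto x0 y0 w"
  shows "smooth_upto x0 y0 (\<lambda>x y. c * w x y)"
    and "\<And>m n. pd y0 m n (\<lambda>x y. c * w x y) x0 y0 = c * pd y0 m n w x0 y0"
proof -
  obtain r where r: "r > 0" and w: "deriv_family x0 y0 r (\<lambda>m n. pd y0 m n w)"
    using smooth_upto_deriv_familyE[OF assms] .
  have "deriv_family x0 y0 r (\<lambda>m n x y. c * pd y0 m n w x y)"
    using deriv_familyD[OF w] unfolding deriv_family_def
    by (auto intro!: DERIV_cmult continuous_on_mult_left simp: split_beta)
  from smooth_upto_jetsI[OF r this] show "smooth_upto x0 y0 (\<lambda>x y. c * w x y)"
    and "pd y0 m n (\<lambda>x y. c * w x y) x0 y0 = c * pd y0 m n w x0 y0" for m n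
    by simp_all
qed

lemma smooth_upto_ddx:
  assumes "smooth_upto x0 y0 w"
  shows "smooth_upto x0 y0 (ddx w)"
    and "\<And>m n. pd y0 m n (ddx w) x0 y0 = pd y0 (Suc m) n w x0 y0"
proof -
  obtain r where r: "r > 0" and w: "deriv_family x0 y0 r (\<lambda>m n. pd y0 m n w)"
    using smooth_upto_deriv_familyE[OF assms] .
  have "deriv_family x0 y0 r (\<lambda>m n. pd y0 (Suc m) n w)"
    using deriv_familyD[OF w] unfolding deriv_family_def by blast
  from smooth_upto_jetsI[OF r this] show "smooth_upto x0 y0 (ddx w)"
    and "pd y0 m n (ddx w) x0 y0 = pd y0 (Suc m) n w x0 y0" for m n
    by (simp_all add: pd_def)
qed

lemma smooth_upto_ddy:
  assumes "smooth_upto x0 y0 w"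
  shows "smooth_upto x0 y0 (ddy y0 w)"
    and "\<And>m n. pd y0 m n (ddy y0 w) x0 y0 = pd y0 m (Suc n) w x0 y0"
proof -
  obtain r where r: "r > 0" and w: "deriv_family x0 y0 r (\<lambda>m n. pd y0 m n w)"
    using smooth_upto_deriv_familyE[OF assms] .
  have "deriv_family x0 y0 r (\<lambda>m n. pd y0 m (Suc n) w)"
    using deriv_familyD[OF w] unfolding deriv_family_def by blast
  from smooth_upto_jetsI[OF r this] show "smooth_upto x0 y0 (ddy y0 w)"
    and "pd y0 m n (ddy y0 w) x0 y0 = pd y0 m (Suc n) w x0 y0" for m n
    by (simp_all add: pd_def)
qed

text \<open>
Pascal's rule in the form needed for Leibniz' formula: differentiating each product in the \<open>m\<close>-th sum gives
the sum for \<open>m + 1\<close>.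
\<close>

lemma leibniz_step:
  fixes F :: "nat \<Rightarrow> nat \<Rightarrow> 'a :: comm_semiring_1"
  shows "(\<Sum>i\<le>m. of_nat (m choose i) * (F (Suc (m - i)) i + F (m - i) (Suc i)))
    = (\<Sum>i\<le>Suc m. of_nat (Suc m choose i) * F (Suc m - i) i)"
proof -
  have "(\<Sum>i\<le>Suc m. of_nat (Suc m choose i) * F (Suc m - i) i)
      = F (Suc m) 0 + (\<Sum>i\<le>m. of_nat (Suc m choose Suc i) * F (m - i) (Suc i))"
    by (subst sum.atMost_Suc_shift) simp
  also have "(\<Sum>i\<le>m. of_nat (Suc m choose Suc i) * F (m - i) (Suc i))
      = (\<Sum>i\<le>m. of_nat (m choose i) * F (m - i) (Suc i))
        + (\<Sum>i\<le>m. of_nat (m choose Suc i) * F (m - i) (Suc i))"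
    by (simp add: sum.distrib ring_distribs)
  also have "(\<Sum>i\<le>m. of_nat (m choose Suc i) * F (m - i) (Suc i))
      = (\<Sum>i<m. of_nat (m choose Suc i) * F (Suc (m - Suc i)) (Suc i))"
    by (intro sum.mono_neutral_cong_right) (auto simp: Suc_diff_Suc le_less binomial_eq_0)
  finally have "(\<Sum>i\<le>Suc m. of_nat (Suc m choose i) * F (Suc m - i) i)
      = (\<Sum>i\<le>m. of_nat (m choose i) * F (m - i) (Suc i))
        + (F (Suc m) 0 + (\<Sum>i<m. of_nat (m choose Suc i) * F (Suc (m - Suc i)) (Suc i)))"
    by (simp add: ac_simps)
  also have "F (Suc m) 0 + (\<Sum>i<m. of_nat (m choose Suc i) * F (Suc (m - Suc i)) (Suc i))
      = (\<Sum>i\<le>m. of_nat (m choose i) * F (Suc (m - i)) i)"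
    by (cases m) (simp_all add: lessThan_Suc_atMost sum.atMost_Suc_shift del: sum.atMost_Suc)
  finally show ?thesis by (simp add: sum.distrib ring_distribs add.commute)
qed

text \<open>
Leibniz' formula in two variables: the jet of a product in terms of the jets of its factors.
\<close>

definition jet_mult :: "(nat \<Rightarrow> nat \<Rightarrow> real) \<Rightarrow> (nat \<Rightarrow> nat \<Rightarrow> real) \<Rightarrow> nat \<Rightarrow> nat \<Rightarrow> real" where
  "jet_mult \<alpha> \<omega> m n =
     (\<Sum>i\<le>m. of_nat (m choose i) * (\<Sum>j\<le>n. of_nat (n choose j) * (\<alpha> (m - i) (n - j) * \<omega> i j)))"

lemma jet_mult_Suc_left:
  "(\<Sum>i\<le>m. of_nat (m choose i) * (\<Sum>j\<le>n. of_nat (n choose j) *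
      (\<alpha> (Suc (m - i)) (n - j) * \<omega> i j + \<alpha> (m - i) (n - j) * \<omega> (Suc i) j)))
    = jet_mult \<alpha> \<omega> (Suc m) n"
  using leibniz_step[of m "\<lambda>k i. (\<Sum>j\<le>n. of_nat (n choose j) * (\<alpha> k (n - j) * \<omega> i j))"]
  by (simp add: jet_mult_def sum.distrib ring_distribs)

lemma jet_mult_Suc_right:
  "(\<Sum>i\<le>m. of_nat (m choose i) * (\<Sum>j\<le>n. of_nat (n choose j) *
      (\<alpha> (m - i) (Suc (n - j)) * \<omega> i j + \<alpha> (m - i) (n - j) * \<omega> i (Suc j))))
    = jet_mult \<alpha> \<omega> m (Suc n)"
  using leibniz_step[of n "\<lambda>k j. \<alpha> (m - i) k * \<omega> i j" for i]
  by (simp add: jet_mult_def del: sum.atMost_Suc)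

lemma smooth_upto_mult:
  assumes "smooth_upto x0 y0 v" "smooth_upto x0 y0 w"
  shows "smooth_upto x0 y0 (\<lambda>x y. v x y * w x y)"
    and "\<And>m n. pd y0 m n (\<lambda>x y. v x y * w x y) x0 y0
       = jet_mult (\<lambda>m n. pd y0 m n v x0 y0) (\<lambda>m n. pd y0 m n w x0 y0) m n"
proof -
  obtain r where r: "r > 0" and v: "deriv_family x0 y0 r (\<lambda>m n. pd y0 m n v)"
    and w: "deriv_family x0 y0 r (\<lambda>m n. pd y0 m n w)"
    using common_deriv_family[OF assms] .
  let ?D = "\<lambda>m n x y. jet_mult (\<lambda>m n. pd y0 m n v x y) (\<lambda>m n. pd y0 m n w x y) m n"
  have "deriv_family x0 y0 r ?D"
    unfolding deriv_family_def
  proof (intro allI conjI impI)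
    fix m n x y assume xy: "(x, y) \<in> half_nbhd x0 y0 r"
    note dv = deriv_familyD(1,2)[OF v xy] and dw = deriv_familyD(1,2)[OF w xy]
    show "((\<lambda>s. ?D m n s y) has_real_derivative ?D (Suc m) n x y) (at x)"
      unfolding jet_mult_Suc_left[symmetric] unfolding jet_mult_def
      by (intro DERIV_sum DERIV_cmult)
         (rule DERIV_cong[OF DERIV_mult[OF dv(1) dw(1)]], simp add: algebra_simps)
    show "((\<lambda>t. ?D m n x t) has_real_derivative ?D m (Suc n) x y) (at y within {..y0})"
      unfolding jet_mult_Suc_right[symmetric] unfolding jet_mult_def
      by (intro DERIV_sum DERIV_cmult)
         (rule DERIV_cong[OF DERIV_mult[OF dv(2) dw(2)]], simp add: algebra_simps)
  next
    fix m n
    show "continuous_on (half_nbhd x0 y0 r) (\<lambda>(x, y). ?D m n x y)"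
      using deriv_familyD(3)[OF v] deriv_familyD(3)[OF w]
      unfolding jet_mult_def split_beta by (intro continuous_intros)
  qed
  from smooth_upto_jetsI[OF r this] show "smooth_upto x0 y0 (\<lambda>x y. v x y * w x y)"
    and "pd y0 m n (\<lambda>x y. v x y * w x y) x0 y0
       = jet_mult (\<lambda>m n. pd y0 m n v x0 y0) (\<lambda>m n. pd y0 m n w x0 y0) m n" for m n
    by (simp_all add: jet_mult_def)
qed

text \<open>
The jet of \<open>- div (a grad u)\<close> as a function of the jets of \<open>a\<close> and \<open>u\<close> alone.
\<close>

definition source_jet ::
  "(nat \<Rightarrow> nat \<Rightarrow> real) \<Rightarrow> (nat \<Rightarrow> nat \<Rightarrow> real) \<Rightarrow> nat \<Rightarrow> nat \<Rightarrow> real" where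
  "source_jet \<alpha> \<omega> m n =
     - (jet_mult \<alpha> (\<lambda>i j. \<omega> (Suc i) j) (Suc m) n + jet_mult \<alpha> (\<lambda>i j. \<omega> i (Suc j)) m (Suc n))"

lemma pd_source:
  assumes a: "smooth_upto x0 y0 a" and u: "smooth_upto x0 y0 u"
  shows "pd y0 m n (source y0 a u) x0 y0
    = source_jet (\<lambda>m n. pd y0 m n a x0 y0) (\<lambda>m n. pd y0 m n u x0 y0) m n"
proof -
  have "source y0 a u = (\<lambda>x y. (- 1) *
      (ddx (\<lambda>x y. a x y * ddx u x y) x y + ddy y0 (\<lambda>x y. a x y * ddy y0 u x y) x y))"
    by (simp add: source_def)
  then show ?thesis
    by (simp only: source_jet_def smooth_upto_cmult smooth_upto_add smooth_upto_mult
        smooth_upto_ddx smooth_upto_ddy a u) simp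
qed

text \<open>
Viewing \<open>\<beta>\<close> as a function of two variables lets the boundary operator use the same product rule as the
equation.
\<close>

lemma smooth_upto_fun_of_x:
  assumes "smooth_at x0 b"
  shows "smooth_upto x0 y0 (\<lambda>x y. b x)"
    and "\<And>m n. pd y0 m n (\<lambda>x y. b x) x0 y0 = (if n = 0 then (deriv ^^ m) b x0 else 0)"
proof -
  obtain r where r: "r > 0" and
    d: "\<And>n x. x \<in> {x0 - r<..<x0 + r} \<Longrightarrow> (deriv ^^ n) b differentiable (at x)"
    using assms unfolding smooth_at_def by blast
  let ?D = "\<lambda>m n x y::real. if n = 0 then (deriv ^^ m) b x else (0::real)"
  have "deriv_family x0 y0 r ?D"
    unfolding deriv_family_def
  proof (intro allI conjI impI)
    fix m n :: nat and x y :: real assume "(x, y) \<in> half_nbhd x0 y0 r"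
    then have x: "x \<in> {x0 - r<..<x0 + r}" by (simp add: half_nbhd_def)
    have "((deriv ^^ m) b has_real_derivative (deriv ^^ Suc m) b x) (at x)"
      using d[OF x, of m] by (simp add: DERIV_deriv_iff_real_differentiable)
    then show "((\<lambda>s. ?D m n s y) has_real_derivative ?D (Suc m) n x y) (at x)"
      by simp
    show "((\<lambda>t. ?D m n x t) has_real_derivative ?D m (Suc n) x y) (at y within {..y0})"
      by simp
  next
    fix m n :: nat
    have "continuous_on {x0 - r<..<x0 + r} ((deriv ^^ m) b)"
      using d[of _ m] by (intro continuous_at_imp_continuous_on ballI)
        (auto intro: differentiable_imp_continuous_within)
    then have "continuous_on (half_nbhd x0 y0 r) (\<lambda>p. (deriv ^^ m) b (fst p))"
      by (rule continuous_on_compose2) (auto simp: half_nbhd_def intro!: continuous_intros)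
    then show "continuous_on (half_nbhd x0 y0 r) (\<lambda>(x, y). ?D m n x y)"
      by (cases "n = 0") (auto simp: split_beta)
  qed
  from smooth_upto_jetsI[OF r this] show "smooth_upto x0 y0 (\<lambda>x y. b x)"
    and "pd y0 m n (\<lambda>x y. b x) x0 y0 = (if n = 0 then (deriv ^^ m) b x0 else 0)" for m n
    by simp_all
qed

lemma higher_deriv_on_line: "(deriv ^^ m) (\<lambda>x. w x y) = (\<lambda>x. pd y0 m 0 w x y)"
  by (induction m) (auto simp: pd_def ddx_def)

lemma deriv_boundary_data:
  assumes b: "smooth_at x0 b" and u: "smooth_upto x0 y0 u"
  shows "(deriv ^^ m) (boundary_data y0 b u) x0 = pd y0 m 1 u x0 y0
    + (\<Sum>i\<le>m. of_nat (m choose i) * ((deriv ^^ (m - i)) b x0 * pd y0 i 0 u x0 y0))"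
proof -
  have "(deriv ^^ m) (boundary_data y0 b u) x0
      = pd y0 m 0 (\<lambda>x y. ddy y0 u x y + b x * u x y) x0 y0"
    unfolding boundary_data_def
    using higher_deriv_on_line[of m "\<lambda>x y. ddy y0 u x y + b x * u x y" y0] by metis
  then show ?thesis
    by (simp add: smooth_upto_add smooth_upto_mult smooth_upto_ddy smooth_upto_fun_of_x b u
        jet_mult_def)
qed

section \<open>Taylor expansion at a boundary point\<close>

definition monomial :: "nat \<Rightarrow> nat \<Rightarrow> real \<Rightarrow> real \<Rightarrow> real" where
  "monomial p q x y = x ^ p * y ^ q / (fact p * fact q)"

lemma taylor_x:
  assumes "r > 0" and D: "\<And>p x. x \<in> {x0 - r<..<x0 + r} \<Longrightarrow>
     (D p has_real_derivative D (Suc p) x) (at x)"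
  shows "(\<lambda>h. D 0 (x0 + k * h) - (\<Sum>p\<le>n. D p x0 * (k * h) ^ p / fact p))
    \<in> O[at_right 0](\<lambda>h. h ^ Suc n)"
proof -
  let ?S = "{x0 - r / 2..x0 + r / 2}"
  have S: "x \<in> {x0 - r<..<x0 + r}" if "x \<in> ?S" for x using that \<open>r > 0\<close> by auto
  have "continuous_on ?S (D (Suc n))"
    using D[OF S, of _ "Suc n"] by (intro continuous_at_imp_continuous_on ballI DERIV_isCont)
  then have "bounded (D (Suc n) ` ?S)"
    by (intro compact_imp_bounded compact_continuous_image) auto
  then obtain B where B: "\<And>x. x \<in> ?S \<Longrightarrow> norm (D (Suc n) x) \<le> B"
    unfolding bounded_iff by (metis imageI)
  have ev: "eventually (\<lambda>h. x0 + k * h \<in> ?S) (at_right 0)"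
  proof -
    have "((\<lambda>h. x0 + k * h) \<longlongrightarrow> x0 + k * 0) (at_right 0)"
      by (intro tendsto_intros)
    then have "eventually (\<lambda>h. x0 + k * h \<in> {x0 - r/2<..<x0 + r/2}) (at_right 0)"
      by (rule topological_tendstoD) (use \<open>r > 0\<close> in auto)
    then show ?thesis by eventually_elim auto
  qed
  show ?thesis
  proof (rule bigoI[where c = "B * \<bar>k\<bar> ^ Suc n / fact n"])
    show "eventually (\<lambda>h. norm (D 0 (x0 + k * h) - (\<Sum>p\<le>n. D p x0 * (k * h) ^ p / fact p))
        \<le> B * \<bar>k\<bar> ^ Suc n / fact n * norm (h ^ Suc n)) (at_right 0)"
      using ev
    proof eventually_elim
      case (elim h)
      have "norm (D 0 (x0 + k * h) - (\<Sum>p\<le>n. D p x0 * (x0 + k * h - x0) ^ p / fact p))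
          \<le> B * norm (x0 + k * h - x0) ^ Suc n / fact n"
      proof (rule field_Taylor[where S = ?S])
        fix i x assume "x \<in> ?S"
        then show "(D i has_field_derivative D (Suc i) x) (at x within ?S)"
          using D[OF S] by (blast intro: has_field_derivative_at_within)
      qed (use B elim \<open>r > 0\<close> in auto)
      then show ?case by (simp add: abs_mult power_mult_distrib mult_ac power_abs)
    qed
  qed
qed

lemma taylor_y:
  assumes D: "deriv_family x0 y0 r D" and "r > 0" and l: "l \<le> 0"
  shows "(\<lambda>h. D 0 0 (x0 + k * h) (y0 + l * h)
      - (\<Sum>q\<le>n. D 0 q (x0 + k * h) y0 * (l * h) ^ q / fact q)) \<in> O[at_right 0](\<lambda>h. h ^ Suc n)"
proof -
  let ?X = "{x0 - r / 2..x0 + r / 2}" and ?Y = "{y0 - r / 2..y0}"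
  have XY: "(x, y) \<in> half_nbhd x0 y0 r" if "x \<in> ?X" "y \<in> ?Y" for x y
    using that \<open>r > 0\<close> by (auto simp: half_nbhd_def)
  have "continuous_on (?X \<times> ?Y) (\<lambda>(x, y). D 0 (Suc n) x y)"
    by (rule continuous_on_subset[OF deriv_familyD(3)[OF D]]) (use XY in auto)
  then have "bounded ((\<lambda>(x, y). D 0 (Suc n) x y) ` (?X \<times> ?Y))"
    by (intro compact_imp_bounded compact_continuous_image compact_Times) auto
  then obtain B where B: "\<And>x y. x \<in> ?X \<Longrightarrow> y \<in> ?Y \<Longrightarrow> norm (D 0 (Suc n) x y) \<le> B"
    unfolding bounded_iff by fastforce
  have evx: "eventually (\<lambda>h. x0 + k * h \<in> {x0 - r/2<..<x0 + r/2}) (at_right 0)"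
  proof -
    have "((\<lambda>h. x0 + k * h) \<longlongrightarrow> x0 + k * 0) (at_right 0)"
      by (intro tendsto_intros)
    then show ?thesis by (rule topological_tendstoD) (use \<open>r > 0\<close> in auto)
  qed
  have evy: "eventually (\<lambda>h. y0 + l * h \<in> {y0 - r/2<..}) (at_right 0)"
  proof -
    have "((\<lambda>h. y0 + l * h) \<longlongrightarrow> y0 + l * 0) (at_right 0)"
      by (intro tendsto_intros)
    then show ?thesis by (rule topological_tendstoD) (use \<open>r > 0\<close> in auto)
  qed
  show ?thesis
  proof (rule bigoI[where c = "B * \<bar>l\<bar> ^ Suc n / fact n"])
    show "eventually (\<lambda>h. norm (D 0 0 (x0 + k * h) (y0 + l * h)
        - (\<Sum>q\<le>n. D 0 q (x0 + k * h) y0 * (l * h) ^ q / fact q))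
        \<le> B * \<bar>l\<bar> ^ Suc n / fact n * norm (h ^ Suc n)) (at_right 0)"
      using evx evy eventually_at_right_less[of 0]
    proof eventually_elim
      case (elim h)
      have y: "y0 + l * h \<in> ?Y" using elim l by (auto simp: mult_nonpos_nonneg)
      let ?x = "x0 + k * h"
      have x: "?x \<in> ?X" using elim by auto
      have "norm (D 0 0 ?x (y0 + l * h) - (\<Sum>q\<le>n. D 0 q ?x y0 * (y0 + l * h - y0) ^ q / fact q))
          \<le> B * norm (y0 + l * h - y0) ^ Suc n / fact n"
      proof (rule field_Taylor[where S = ?Y and f = "\<lambda>q. D 0 q ?x"])
        fix i y assume y: "y \<in> ?Y"
        show "(D 0 i ?x has_field_derivative D 0 (Suc i) ?x y) (at y within ?Y)"
          using deriv_familyD(2)[OF D XY[OF x y], of 0 i] by (rule DERIV_subset) auto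
      qed (use B x y \<open>r > 0\<close> in auto)
      then show ?case by (simp add: abs_mult power_mult_distrib mult_ac power_abs)
    qed
  qed
qed

lemma Lam_eq_Sigma: "Lam N = prod.swap ` (SIGMA q:{..N}. {..N - q})"
  by (force simp: Lam_def)

lemma finite_Lam [simp]: "finite (Lam N)"
  by (simp add: Lam_eq_Sigma)

lemma sum_Lam:
  fixes f :: "nat \<Rightarrow> nat \<Rightarrow> 'a :: comm_monoid_add"
  shows "(\<Sum>(p, q)\<in>Lam N. f p q) = (\<Sum>q\<le>N. \<Sum>p\<le>N - q. f p q)"
  by (simp add: Lam_eq_Sigma sum.reindex sum.Sigma split_beta)

text \<open>
Expanding in \<open>y\<close> from the boundary line first and then in \<open>x\<close> along this line needs one-dimensional Taylor
formulas only.  The \<open>q\<close>-th coefficient of the first expansion comes with a factor \<open>h^q\<close>, so it may be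
truncated at order \<open>N - q\<close>.
\<close>

lemma taylor_half_nbhd:
  assumes u: "smooth_upto x0 y0 u" and l: "l \<le> 0"
  shows "(\<lambda>h. u (x0 + k * h) (y0 + l * h)
      - (\<Sum>(p, q)\<in>Lam N. pd y0 p q u x0 y0 * monomial p q (k * h) (l * h)))
    \<in> O[at_right 0](\<lambda>h. h ^ Suc N)"
proof -
  obtain r where r: "r > 0" and D: "deriv_family x0 y0 r (\<lambda>m n. pd y0 m n u)"
    using smooth_upto_deriv_familyE[OF u] .
  have "(\<lambda>h. (u (x0 + k * h) (y0 + l * h)
        - (\<Sum>q\<le>N. pd y0 0 q u (x0 + k * h) y0 * (l * h) ^ q / fact q))
      + (\<Sum>q\<le>N. (pd y0 0 q u (x0 + k * h) y0
            - (\<Sum>p\<le>N - q. pd y0 p q u x0 y0 * (k * h) ^ p / fact p)) * ((l * h) ^ q / fact q)))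
    \<in> O[at_right 0](\<lambda>h. h ^ Suc N)"
  proof (rule sum_in_bigo(1)[OF _ big_sum_in_bigo])
    show "(\<lambda>h. u (x0 + k * h) (y0 + l * h)
        - (\<Sum>q\<le>N. pd y0 0 q u (x0 + k * h) y0 * (l * h) ^ q / fact q))
      \<in> O[at_right 0](\<lambda>h. h ^ Suc N)"
      using taylor_y[OF D r l, of k N] by simp
  next
    fix q assume q: "q \<in> {..N}"
    have "(\<lambda>h. pd y0 0 q u (x0 + k * h) y0
            - (\<Sum>p\<le>N - q. pd y0 p q u x0 y0 * (k * h) ^ p / fact p))
        \<in> O[at_right 0](\<lambda>h. h ^ Suc (N - q))"
      by (rule taylor_x[where D = "\<lambda>p x. pd y0 p q u x y0", OF r])
         (use r in \<open>auto intro!: deriv_familyD(1)[OF D] simp: half_nbhd_def\<close>)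
    moreover have "(\<lambda>h. (l * h) ^ q / fact q) \<in> O[at_right 0](\<lambda>h. h ^ q)"
      by (intro bigoI[where c = "\<bar>l\<bar> ^ q / fact q"]) (simp add: power_mult_distrib abs_mult power_abs)
    ultimately have "(\<lambda>h. (pd y0 0 q u (x0 + k * h) y0
            - (\<Sum>p\<le>N - q. pd y0 p q u x0 y0 * (k * h) ^ p / fact p)) * ((l * h) ^ q / fact q))
        \<in> O[at_right 0](\<lambda>h. h ^ Suc (N - q) * h ^ q)"
      by (rule landau_o.big.mult)
    moreover have "(\<lambda>h::real. h ^ Suc (N - q) * h ^ q) = (\<lambda>h. h ^ Suc N)"
      using q by (simp del: power_Suc flip: power_add)
    ultimately show "(\<lambda>h. (pd y0 0 q u (x0 + k * h) y0
            - (\<Sum>p\<le>N - q. pd y0 p q u x0 y0 * (k * h) ^ p / fact p)) * ((l * h) ^ q / fact q))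
        \<in> O[at_right 0](\<lambda>h. h ^ Suc N)" by simp
  qed
  also have "(\<lambda>h. (u (x0 + k * h) (y0 + l * h)
        - (\<Sum>q\<le>N. pd y0 0 q u (x0 + k * h) y0 * (l * h) ^ q / fact q))
      + (\<Sum>q\<le>N. (pd y0 0 q u (x0 + k * h) y0
            - (\<Sum>p\<le>N - q. pd y0 p q u x0 y0 * (k * h) ^ p / fact p)) * ((l * h) ^ q / fact q)))
    = (\<lambda>h. u (x0 + k * h) (y0 + l * h)
      - (\<Sum>(p, q)\<in>Lam N. pd y0 p q u x0 y0 * monomial p q (k * h) (l * h)))"
  proof -
    have "(\<Sum>p\<le>N - q. pd y0 p q u x0 y0 * monomial p q x y)
        = (\<Sum>p\<le>N - q. pd y0 p q u x0 y0 * x ^ p / fact p) * (y ^ q / fact q)" for q x y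
      unfolding sum_distrib_right by (intro sum.cong) (simp_all add: monomial_def)
    then show ?thesis by (simp add: sum_Lam left_diff_distrib sum_subtractf diff_divide_distrib)
  qed
  finally show ?thesis .
qed

section \<open>Polynomials with prescribed jets\<close>

text \<open>
The \<open>m\<close>-th derivative of \<open>x^p / p!\<close>.
\<close>

definition divpow :: "nat \<Rightarrow> nat \<Rightarrow> real \<Rightarrow> real" where
  "divpow p m x = (if m \<le> p then x ^ (p - m) / fact (p - m) else 0)"

lemma divpow_0: "divpow p m 0 = (if p = m then 1 else 0)"
  by (simp add: divpow_def power_0_left)

lemma DERIV_divpow [derivative_intros]:
  "((\<lambda>s. divpow p m (s - c)) has_real_derivative divpow p (Suc m) (x - c)) (at x within S)"
proof (cases "m < p")
  case True
  then obtain j where j: "p - m = Suc j" "p - Suc m = j" by (metis Suc_diff_Suc diff_Suc_Suc)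
  have "((\<lambda>s. (s - c) ^ Suc j / fact (Suc j)) has_real_derivative (x - c) ^ j / fact j) (at x within S)"
    by (rule derivative_eq_intros refl | simp)+
  then show ?thesis using True j by (simp add: divpow_def)
next
  case False
  then show ?thesis by (cases "m = p") (auto simp: divpow_def)
qed

text \<open>
Divided monomials make the coefficients equal to the derivatives at the base point.  Identities that hold for
all smooth \<open>u\<close> can thus be tested on arbitrarily prescribed jets.
\<close>

definition jet_poly :: "real \<Rightarrow> real \<Rightarrow> nat \<Rightarrow> (nat \<Rightarrow> nat \<Rightarrow> real) \<Rightarrow> real \<Rightarrow> real \<Rightarrow> real" where
  "jet_poly x0 y0 N c x y = (\<Sum>(p, q)\<in>Lam N. c p q * monomial p q (x - x0) (y - y0))"

lemma jet_poly_smooth_upto: "smooth_upto x0 y0 (jet_poly x0 y0 N c)"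
  and pd_jet_poly: "pd y0 m n (jet_poly x0 y0 N c) x0 y0 = (if m + n \<le> N then c m n else 0)"
proof -
  let ?D = "\<lambda>m n x y. \<Sum>(p, q)\<in>Lam N. c p q * (divpow p m (x - x0) * divpow q n (y - y0))"
  have D: "deriv_family x0 y0 1 ?D"
    unfolding deriv_family_def split_beta
  proof (intro allI conjI impI)
    fix m n x y
    show "((\<lambda>s. \<Sum>z\<in>Lam N. c (fst z) (snd z) * (divpow (fst z) m (s - x0) * divpow (snd z) n (y - y0)))
        has_real_derivative
          (\<Sum>z\<in>Lam N. c (fst z) (snd z) * (divpow (fst z) (Suc m) (x - x0) * divpow (snd z) n (y - y0))))
        (at x)"
      by (intro DERIV_sum DERIV_cmult DERIV_cmult_right DERIV_divpow)
    show "((\<lambda>t. \<Sum>z\<in>Lam N. c (fst z) (snd z) * (divpow (fst z) m (x - x0) * divpow (snd z) n (t - y0)))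
        has_real_derivative
          (\<Sum>z\<in>Lam N. c (fst z) (snd z) * (divpow (fst z) m (x - x0) * divpow (snd z) (Suc n) (y - y0))))
        (at y within {..y0})"
      by (intro DERIV_sum DERIV_cmult DERIV_cmult_right DERIV_divpow)
  next
    fix m n
    have cont: "continuous_on A (\<lambda>w. divpow p m (f w))" if "continuous_on A f"
      for p m and f :: "real \<times> real \<Rightarrow> real" and A
      using that by (cases "m \<le> p") (auto simp: divpow_def intro!: continuous_intros)
    show "continuous_on (half_nbhd x0 y0 1) (\<lambda>w. \<Sum>z\<in>Lam N. c (fst z) (snd z) *
        (divpow (fst z) m (fst w - x0) * divpow (snd z) n (snd w - y0)))"
      by (intro continuous_intros cont)
  qed
  have 0: "jet_poly x0 y0 N c x y = ?D 0 0 x y" for x y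
    by (simp add: jet_poly_def monomial_def divpow_def)
  show "smooth_upto x0 y0 (jet_poly x0 y0 N c)"
    by (rule smooth_upto_jetsI[OF _ D 0]) simp
  have "pd y0 m n (jet_poly x0 y0 N c) x0 y0 = ?D m n x0 y0"
    by (rule smooth_upto_jetsI[OF _ D 0]) simp
  also have "\<dots> = (\<Sum>z\<in>Lam N. if z = (m, n) then c m n else 0)"
    by (intro sum.cong) (auto simp: divpow_0 split: if_splits)
  also have "\<dots> = (if m + n \<le> N then c m n else 0)"
    by (subst sum.delta[OF finite_Lam]) (simp add: Lam_def)
  finally show "pd y0 m n (jet_poly x0 y0 N c) x0 y0 = (if m + n \<le> N then c m n else 0)" .
qed

section \<open>Elimination of higher normal derivatives\<close>

lemma jet_mult_split:
  "jet_mult \<alpha> \<omega> m n = \<alpha> 0 0 * \<omega> m n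
    + (\<Sum>(i, j)\<in>{..m} \<times> {..n} - {(m, n)}.
         real (m choose i) * real (n choose j) * \<alpha> (m - i) (n - j) * \<omega> i j)"
proof -
  have "jet_mult \<alpha> \<omega> m n = (\<Sum>(i, j)\<in>{..m} \<times> {..n}.
      real (m choose i) * real (n choose j) * \<alpha> (m - i) (n - j) * \<omega> i j)"
    unfolding jet_mult_def sum.cartesian_product[symmetric]
    by (simp add: sum_distrib_left mult.assoc)
  also have "\<dots> = \<alpha> 0 0 * \<omega> m n + (\<Sum>(i, j)\<in>{..m} \<times> {..n} - {(m, n)}.
      real (m choose i) * real (n choose j) * \<alpha> (m - i) (n - j) * \<omega> i j)"
    by (subst sum.remove[of _ "(m, n)"]) auto
  finally show ?thesis .
qed

text \<open>
Below total degree \<open>T\<close> the jet \<open>\<omega>\<close> vanishes, so in Leibniz' formula only the term with all derivatives on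
\<open>\<omega>\<close> survives.  One degree further up, the terms with one derivative on \<open>\<alpha>\<close> join in.
\<close>

lemma jet_mult_leading:
  assumes "\<And>p q. p + q < T \<Longrightarrow> \<omega> p q = 0" and "m + n \<le> T"
  shows "jet_mult \<alpha> \<omega> m n = \<alpha> 0 0 * \<omega> m n"
proof -
  have "(\<Sum>(i, j)\<in>{..m} \<times> {..n} - {(m, n)}.
      real (m choose i) * real (n choose j) * \<alpha> (m - i) (n - j) * \<omega> i j) = 0"
  proof (intro sum.neutral ballI)
    fix z assume "z \<in> {..m} \<times> {..n} - {(m, n)}"
    then obtain i j where z: "z = (i, j)" "i + j < T" using assms(2) by (cases z) auto
    then show "(case z of (i, j) \<Rightarrow>
        real (m choose i) * real (n choose j) * \<alpha> (m - i) (n - j) * \<omega> i j) = 0"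
      by (simp add: assms(1))
  qed
  then show ?thesis by (simp add: jet_mult_split)
qed

lemma jet_mult_subleading:
  assumes "\<And>p q. p + q < T \<Longrightarrow> \<omega> p q = 0" and "m + n = Suc T"
  shows "jet_mult \<alpha> \<omega> m n
    = \<alpha> 0 0 * \<omega> m n + real m * \<alpha> 1 0 * \<omega> (m - 1) n + real n * \<alpha> 0 1 * \<omega> m (n - 1)"
proof -
  let ?f = "\<lambda>(i, j). real (m choose i) * real (n choose j) * \<alpha> (m - i) (n - j) * \<omega> i j"
  let ?P = "if m = 0 then {} else {(m - 1, n)}" and ?Q = "if n = 0 then {} else {(m, n - 1)}"
  have "sum ?f ({..m} \<times> {..n} - {(m, n)}) = sum ?f (?P \<union> ?Q)"
  proof (rule sum.mono_neutral_right)
    show "\<forall>z\<in>{..m} \<times> {..n} - {(m, n)} - (?P \<union> ?Q). ?f z = 0"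
    proof
      fix z assume "z \<in> {..m} \<times> {..n} - {(m, n)} - (?P \<union> ?Q)"
      then obtain i j where z: "z = (i, j)" "i \<le> m" "j \<le> n" "(i, j) \<noteq> (m, n)" "(i, j) \<notin> ?P \<union> ?Q"
        by (cases z) auto
      then have "i + j < T" using assms(2) by (auto split: if_splits)
      then show "?f z = 0" by (simp add: z(1) assms(1))
    qed
  qed auto
  also have "\<dots> = sum ?f ?P + sum ?f ?Q"
    by (rule sum.union_disjoint) auto
  also have "sum ?f ?P = real m * \<alpha> 1 0 * \<omega> (m - 1) n"
    by (cases m) simp_all
  also have "sum ?f ?Q = real n * \<alpha> 0 1 * \<omega> m (n - 1)"
    by (cases n) simp_all
  finally show ?thesis by (simp add: jet_mult_split)
qed

text \<open>
To leading order the equation is Laplace's equation with the constant coefficient \<open>a x0 y0\<close>.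
\<close>

lemma source_jet_leading:
  assumes "\<And>p q. p + q < T \<Longrightarrow> \<omega> p q = 0" and "m + n + 2 \<le> T"
  shows "source_jet \<alpha> \<omega> m n = - \<alpha> 0 0 * (\<omega> (m + 2) n + \<omega> m (n + 2))"
  unfolding source_jet_def
  by (subst (1 2) jet_mult_leading[of "T - 1"]) (use assms in \<open>auto simp: algebra_simps\<close>)

lemma source_jet_subleading:
  assumes "\<And>p q. p + q < T \<Longrightarrow> \<omega> p q = 0" and "m + n + 1 = T"
  shows "source_jet \<alpha> \<omega> m n = - (\<alpha> 0 0 * (\<omega> (m + 2) n + \<omega> m (n + 2))
    + \<alpha> 1 0 * (real (m + 1) * \<omega> (m + 1) n + (if m = 0 then 0 else real m * \<omega> (m - 1) (n + 2)))
    + \<alpha> 0 1 * ((if n = 0 then 0 else real n * \<omega> (m + 2) (n - 1)) + real (n + 1) * \<omega> m (n + 1)))"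
  unfolding source_jet_def
  by (subst (1 2) jet_mult_subleading[of "T - 1"]) (use assms in \<open>auto simp: algebra_simps\<close>)

lemma finite_LamH1 [simp]: "finite (LamH1 N)"
  by (rule finite_subset[OF _ finite_Lam[of N]]) (auto simp: LamH1_def)

lemma finite_source_orders [simp]: "finite {(m, n). m + n + 2 \<le> (T::nat)}"
  by (rule finite_subset[OF _ finite_Lam[of T]]) (auto simp: Lam_def)

text \<open>
The functionals of \<open>u\<close> that can be expressed by the Cauchy jet and the jet of the source up to total order \<open>T\<close>
(where \<open>f\<close> counts as of order two), with coefficients independent of \<open>u\<close>.  This is the shape of the elimination
identity for one derivative, and it is closed under linear combinations.
\<close>

definition reducible ::
  "real \<Rightarrow> real \<Rightarrow> (real \<Rightarrow> real \<Rightarrow> real) \<Rightarrow> nat \<Rightarrow> ((real \<Rightarrow> real \<Rightarrow> real) \<Rightarrow> real) \<Rightarrow> bool" where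
  "reducible x0 y0 a T \<phi> \<longleftrightarrow> (\<exists>A B. \<forall>u. smooth_upto x0 y0 u \<longrightarrow>
     \<phi> u = (\<Sum>(m, n)\<in>LamH1 T. A m n * pd y0 m n u x0 y0)
       + (\<Sum>(m, n)\<in>{(m, n). m + n + 2 \<le> T}. B m n * pd y0 m n (source y0 a u) x0 y0))"

lemma reducibleI:
  assumes "\<And>u. smooth_upto x0 y0 u \<Longrightarrow>
     \<phi> u = (\<Sum>(m, n)\<in>LamH1 T. A m n * pd y0 m n u x0 y0)
       + (\<Sum>(m, n)\<in>{(m, n). m + n + 2 \<le> T}. B m n * pd y0 m n (source y0 a u) x0 y0)"
  shows "reducible x0 y0 a T \<phi>"
  using assms unfolding reducible_def by blast

lemma reducibleE:
  assumes "reducible x0 y0 a T \<phi>"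
  obtains A B where "\<And>u. smooth_upto x0 y0 u \<Longrightarrow>
     \<phi> u = (\<Sum>(m, n)\<in>LamH1 T. A m n * pd y0 m n u x0 y0)
       + (\<Sum>(m, n)\<in>{(m, n). m + n + 2 \<le> T}. B m n * pd y0 m n (source y0 a u) x0 y0)"
  using assms unfolding reducible_def by blast

lemma reducible_mono:
  assumes "reducible x0 y0 a T \<phi>" "T \<le> T'"
  shows "reducible x0 y0 a T' \<phi>"
proof -
  obtain A B where AB: "\<And>u. smooth_upto x0 y0 u \<Longrightarrow>
     \<phi> u = (\<Sum>(m, n)\<in>LamH1 T. A m n * pd y0 m n u x0 y0)
       + (\<Sum>(m, n)\<in>{(m, n). m + n + 2 \<le> T}. B m n * pd y0 m n (source y0 a u) x0 y0)"
    using reducibleE[OF assms(1)] by blast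
  show ?thesis
  proof (rule reducibleI)
    fix u assume u: "smooth_upto x0 y0 u"
    show "\<phi> u = (\<Sum>(m, n)\<in>LamH1 T'. (\<lambda>m n. if m + n \<le> T then A m n else 0) m n * pd y0 m n u x0 y0)
       + (\<Sum>(m, n)\<in>{(m, n). m + n + 2 \<le> T'}.
            (\<lambda>m n. if m + n + 2 \<le> T then B m n else 0) m n * pd y0 m n (source y0 a u) x0 y0)"
      unfolding AB[OF u]
      by (intro arg_cong2[of _ _ _ _ "(+)"] sum.mono_neutral_cong_left finite_LamH1
            finite_source_orders)
         (use assms(2) in \<open>auto simp: LamH1_def Lam_def split: if_splits\<close>)
  qed
qed

lemma reducible_cmult:
  assumes "reducible x0 y0 a T \<phi>"
  shows "reducible x0 y0 a T (\<lambda>u. c * \<phi> u)"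
proof -
  obtain A B where AB: "\<And>u. smooth_upto x0 y0 u \<Longrightarrow>
     \<phi> u = (\<Sum>(m, n)\<in>LamH1 T. A m n * pd y0 m n u x0 y0)
       + (\<Sum>(m, n)\<in>{(m, n). m + n + 2 \<le> T}. B m n * pd y0 m n (source y0 a u) x0 y0)"
    using reducibleE[OF assms] by blast
  show ?thesis
    by (rule reducibleI[where A = "\<lambda>m n. c * A m n" and B = "\<lambda>m n. c * B m n"])
       (simp add: AB distrib_left sum_distrib_left split_beta mult.assoc)
qed

lemma reducible_add:
  assumes "reducible x0 y0 a T \<phi>" "reducible x0 y0 a T \<psi>"
  shows "reducible x0 y0 a T (\<lambda>u. \<phi> u + \<psi> u)"
proof -
  obtain A B where AB: "\<And>u. smooth_upto x0 y0 u \<Longrightarrow>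
     \<phi> u = (\<Sum>(m, n)\<in>LamH1 T. A m n * pd y0 m n u x0 y0)
       + (\<Sum>(m, n)\<in>{(m, n). m + n + 2 \<le> T}. B m n * pd y0 m n (source y0 a u) x0 y0)"
    using reducibleE[OF assms(1)] by blast
  obtain A' B' where AB': "\<And>u. smooth_upto x0 y0 u \<Longrightarrow>
     \<psi> u = (\<Sum>(m, n)\<in>LamH1 T. A' m n * pd y0 m n u x0 y0)
       + (\<Sum>(m, n)\<in>{(m, n). m + n + 2 \<le> T}. B' m n * pd y0 m n (source y0 a u) x0 y0)"
    using reducibleE[OF assms(2)] by blast
  show ?thesis
    by (rule reducibleI[where A = "\<lambda>m n. A m n + A' m n" and B = "\<lambda>m n. B m n + B' m n"])
       (simp add: AB AB' distrib_right sum.distrib split_beta)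
qed

lemma reducible_sum:
  assumes "finite S" "\<And>i. i \<in> S \<Longrightarrow> reducible x0 y0 a T (\<phi> i)"
  shows "reducible x0 y0 a T (\<lambda>u. \<Sum>i\<in>S. \<phi> i u)"
  using assms
proof (induction S rule: finite_induct)
  case empty
  show ?case
    by (rule reducibleI[where A = "\<lambda>_ _. 0" and B = "\<lambda>_ _. 0"]) simp
next
  case (insert i S)
  then show ?case by (simp add: reducible_add)
qed

lemma sum_kronecker_pair:
  fixes f :: "nat \<Rightarrow> nat \<Rightarrow> real"
  assumes "finite S" "(m, n) \<in> S"
  shows "(\<Sum>(i, j)\<in>S. (if i = m \<and> j = n then 1 else 0) * f i j) = f m n"
proof -
  have "(\<Sum>(i, j)\<in>S. (if i = m \<and> j = n then 1 else 0) * f i j)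
      = (\<Sum>z\<in>S. if z = (m, n) then f m n else 0)"
    by (intro sum.cong) (auto split: if_splits)
  then show ?thesis using assms by simp
qed

lemma reducible_source:
  "reducible x0 y0 a (m + n + 2) (\<lambda>u. pd y0 m n (source y0 a u) x0 y0)"
proof (rule reducibleI)
  fix u
  show "pd y0 m n (source y0 a u) x0 y0
      = (\<Sum>(i, j)\<in>LamH1 (m + n + 2). (\<lambda>_ _. 0) i j * pd y0 i j u x0 y0)
      + (\<Sum>(i, j)\<in>{(i, j). i + j + 2 \<le> m + n + 2}.
          (\<lambda>i j. if i = m \<and> j = n then 1 else 0) i j * pd y0 i j (source y0 a u) x0 y0)"
    by (subst sum_kronecker_pair[OF finite_source_orders]) auto
qed

lemma reducible_cauchy_jet:
  assumes "n \<le> 1"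
  shows "reducible x0 y0 a (m + n) (\<lambda>u. pd y0 m n u x0 y0)"
proof (rule reducibleI)
  fix u
  show "pd y0 m n u x0 y0 = (\<Sum>(i, j)\<in>LamH1 (m + n).
        (\<lambda>i j. if i = m \<and> j = n then 1 else 0) i j * pd y0 i j u x0 y0)
      + (\<Sum>(i, j)\<in>{(i, j). i + j + 2 \<le> m + n}. (\<lambda>_ _. 0) i j * pd y0 i j (source y0 a u) x0 y0)"
    by (subst sum_kronecker_pair[OF finite_LamH1])
       (use assms in \<open>auto simp: LamH1_def Lam_def\<close>)
qed

lemma reducible_cong:
  assumes "\<And>u. smooth_upto x0 y0 u \<Longrightarrow> \<phi> u = \<psi> u" "reducible x0 y0 a T \<psi>"
  shows "reducible x0 y0 a T \<phi>"
  using assms unfolding reducible_def by simp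

text \<open>
In the jet of the source of order \<open>(p, n)\<close>, the derivative \<open>(p, n + 2)\<close> of \<open>u\<close> has the coefficient
\<open>- a x0 y0 \<noteq> 0\<close>.  All others have fewer \<open>y\<close>-derivatives, or equally many and fewer \<open>x\<close>-derivatives, so solving for
it expresses it by derivatives that are already reducible.
\<close>

lemma reducible_jet:
  assumes a: "smooth_upto x0 y0 a" and a0: "a x0 y0 \<noteq> 0"
  shows "reducible x0 y0 a (p + q) (\<lambda>u. pd y0 p q u x0 y0)"
proof (induction q arbitrary: p rule: less_induct)
  case outer: (less q)
  show ?case
  proof (induction p rule: less_induct)
    case inner: (less p)
    show ?case
    proof (cases "q \<le> 1")
      case True then show ?thesis by (rule reducible_cauchy_jet)
    next
      case False
      then obtain n where n: "q = n + 2" by (metis add.commute le_Suc_ex not_less_eq_eq numeral_2_eq_2 One_nat_def)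
      let ?\<alpha> = "\<lambda>i j. pd y0 i j a x0 y0"
      let ?w = "\<lambda>m n i j. real (m choose i) * real (n choose j) * ?\<alpha> (m - i) (n - j)"
      let ?S1 = "{..Suc p} \<times> {..n} - {(Suc p, n)}" and ?S2 = "{..p} \<times> {..Suc n} - {(p, Suc n)}"
      let ?R1 = "\<lambda>u. \<Sum>z\<in>?S1. ?w (Suc p) n (fst z) (snd z) * pd y0 (Suc (fst z)) (snd z) u x0 y0"
      let ?R2 = "\<lambda>u. \<Sum>z\<in>?S2. ?w p (Suc n) (fst z) (snd z) * pd y0 (fst z) (Suc (snd z)) u x0 y0"
      let ?R = "\<lambda>u. (- 1 / a x0 y0) * (pd y0 p n (source y0 a u) x0 y0
          + (a x0 y0 * pd y0 (Suc (Suc p)) n u x0 y0 + (?R1 u + ?R2 u)))"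
      have IH: "reducible x0 y0 a (p + q) (\<lambda>u. pd y0 i j u x0 y0)"
        if "j < q \<or> (j = q \<and> i < p)" "i + j \<le> p + q" for i j
        using that outer inner by (meson reducible_mono)
      have red: "reducible x0 y0 a (p + q) ?R"
      proof (intro reducible_cmult reducible_add reducible_sum)
        show "reducible x0 y0 a (p + q) (\<lambda>u. pd y0 p n (source y0 a u) x0 y0)"
          using reducible_source[of x0 y0 a p n] by (simp add: n add.assoc)
        show "reducible x0 y0 a (p + q) (\<lambda>u. pd y0 (Suc (Suc p)) n u x0 y0)"
          by (rule IH) (auto simp: n)
      next
        fix z assume "z \<in> ?S1"
        then show "reducible x0 y0 a (p + q) (\<lambda>u. pd y0 (Suc (fst z)) (snd z) u x0 y0)"
          by (intro IH) (auto simp: n)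
      next
        fix z assume "z \<in> ?S2"
        then show "reducible x0 y0 a (p + q) (\<lambda>u. pd y0 (fst z) (Suc (snd z)) u x0 y0)"
          by (intro IH) (auto simp: n)
      qed auto
      show ?thesis
      proof (rule reducible_cong[OF _ red])
        fix u assume u: "smooth_upto x0 y0 u"
        have "pd y0 p n (source y0 a u) x0 y0 = - (a x0 y0 * pd y0 (Suc (Suc p)) n u x0 y0 + ?R1 u
            + (a x0 y0 * pd y0 p (Suc (Suc n)) u x0 y0 + ?R2 u))"
          unfolding pd_source[OF a u] source_jet_def jet_mult_split[of _ _ "Suc p" n]
            jet_mult_split[of _ _ p "Suc n"] split_beta pd_0_0 ..
        moreover have "v = (- 1 / a x0 y0) * (f + (a x0 y0 * w + (r + s)))"
          if "f = - (a x0 y0 * w + r + (a x0 y0 * v + s))" for f w r s v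
          using a0 by (simp add: that field_simps)
        ultimately show "pd y0 p q u x0 y0 = ?R u"
          unfolding n add_2_eq_Suc' by blast
      qed
    qed
  qed
qed

lemma is_reduction_exists:
  assumes a: "smooth_upto x0 y0 a" and a0: "a x0 y0 \<noteq> 0"
  shows "\<exists>Au Af. is_reduction x0 y0 a M Au Af"
proof -
  define P where "P p q A B \<longleftrightarrow> (\<forall>u. smooth_upto x0 y0 u \<longrightarrow>
     pd y0 p q u x0 y0 = (\<Sum>(m, n)\<in>LamH1 (p + q). A m n * pd y0 m n u x0 y0)
       + (\<Sum>(m, n)\<in>{(m, n). m + n + 2 \<le> p + q}. B m n * pd y0 m n (source y0 a u) x0 y0))"
    for p q and A B :: "nat \<Rightarrow> nat \<Rightarrow> real"
  have "\<exists>A B. P p q A B" for p q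
    using reducible_jet[OF assms, of p q] unfolding reducible_def P_def .
  then obtain A B where "\<And>p q. P p q (A p q) (B p q)" by metis
  then have AB: "pd y0 p q u x0 y0 = (\<Sum>(m, n)\<in>LamH1 (p + q). A p q m n * pd y0 m n u x0 y0)
       + (\<Sum>(m, n)\<in>{(m, n). m + n + 2 \<le> p + q}. B p q m n * pd y0 m n (source y0 a u) x0 y0)"
    if "smooth_upto x0 y0 u" for p q u
    using that unfolding P_def by blast
  have sets: "{(m, n) \<in> LamH1 (M + 1). m + n \<le> p + q} = LamH1 (p + q)"
    "{(m, n) \<in> Lam (M - 1). m + n + 2 \<le> p + q} = {(m, n). m + n + 2 \<le> p + q}"
    if "(p, q) \<in> LamH2 (M + 1)" for p q
    using that by (auto simp: LamH1_def LamH2_def Lam_def)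
  have "is_reduction x0 y0 a M A B"
    unfolding is_reduction_def
  proof (intro allI impI, clarify)
    fix u p q assume "smooth_upto x0 y0 u" "(p, q) \<in> LamH2 (M + 1)"
    then show "pd y0 p q u x0 y0
        = (\<Sum>(m, n)\<in>{(m, n) \<in> LamH1 (M + 1). m + n \<le> p + q}. A p q m n * pd y0 m n u x0 y0)
        + (\<Sum>(m, n)\<in>{(m, n) \<in> Lam (M - 1). m + n + 2 \<le> p + q}.
             B p q m n * pd y0 m n (source y0 a u) x0 y0)"
      by (simp only: sets) (rule AB)
  qed
  then show ?thesis by blast
qed

lemma is_reduction_AH:
  assumes a: "smooth_upto x0 y0 a" and a0: "a x0 y0 \<noteq> 0"
  shows "is_reduction x0 y0 a M (AHu x0 y0 a M) (AHf x0 y0 a M)"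
proof -
  have "\<exists>R. (\<lambda>(Au, Af). is_reduction x0 y0 a M Au Af) R"
    using is_reduction_exists[OF assms] by simp
  then have "(\<lambda>(Au, Af). is_reduction x0 y0 a M Au Af) (reduction x0 y0 a M)"
    unfolding reduction_def by (rule someI_ex)
  then show ?thesis by (simp add: AHu_def AHf_def split_beta)
qed

section \<open>The elimination coefficients and the functions G and Q\<close>

text \<open>
The elimination coefficients between derivatives of equal total order depend on the leading part of the
equation only.  They are read off by inserting the homogeneous harmonic polynomial whose Cauchy jet is
concentrated at \<open>(m, n)\<close>: its source vanishes to the relevant order.
\<close>

lemma AHu_top:
  assumes a: "smooth_upto x0 y0 a" and a0: "a x0 y0 \<noteq> 0"
    and pq: "(p, q) \<in> LamH2 (M + 1)" and n: "n \<le> 1" and mn: "m + n = p + q"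
  shows "AHu x0 y0 a M p q m n = (if even q = even n then (-1) ^ (q div 2) else 0)"
proof -
  define c :: "nat \<Rightarrow> nat \<Rightarrow> real" where
    "c i j = (if i + j = p + q \<and> even j = even n then (-1) ^ (j div 2) else 0)" for i j
  define u where "u = jet_poly x0 y0 (p + q) c"
  have u: "smooth_upto x0 y0 u" unfolding u_def by (rule jet_poly_smooth_upto)
  have jet: "pd y0 i j u x0 y0 = c i j" for i j
    unfolding u_def by (auto simp: pd_jet_poly c_def)
  have f: "pd y0 i j (source y0 a u) x0 y0 = 0" if "i + j + 2 \<le> p + q" for i j
    unfolding pd_source[OF a u] jet
    by (subst source_jet_leading[OF _ that]) (auto simp: c_def)
  have "c p q = (\<Sum>(i, j)\<in>{(i, j) \<in> LamH1 (M + 1). i + j \<le> p + q}. AHu x0 y0 a M p q i j * c i j)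
      + (\<Sum>(i, j)\<in>{(i, j) \<in> Lam (M - 1). i + j + 2 \<le> p + q}.
          AHf x0 y0 a M p q i j * pd y0 i j (source y0 a u) x0 y0)"
    using is_reduction_AH[OF a a0, of M, unfolded is_reduction_def] u pq jet by fastforce
  also have "(\<Sum>(i, j)\<in>{(i, j) \<in> Lam (M - 1). i + j + 2 \<le> p + q}.
          AHf x0 y0 a M p q i j * pd y0 i j (source y0 a u) x0 y0) = 0"
    by (intro sum.neutral) (auto simp: f)
  also have "(\<Sum>(i, j)\<in>{(i, j) \<in> LamH1 (M + 1). i + j \<le> p + q}. AHu x0 y0 a M p q i j * c i j)
      = (\<Sum>z\<in>{(i, j) \<in> LamH1 (M + 1). i + j \<le> p + q}.
          if z = (m, n) then AHu x0 y0 a M p q m n else 0)"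
    using n mn by (intro sum.cong) (auto simp: c_def LamH1_def le_Suc_eq split: if_splits)
  also have "\<dots> = AHu x0 y0 a M p q m n"
  proof -
    have "finite {(i, j) \<in> LamH1 (M + 1). i + j \<le> p + q}"
      by (rule finite_subset[OF _ finite_LamH1[of "M + 1"]]) auto
    moreover have "(m, n) \<in> {(i, j) \<in> LamH1 (M + 1). i + j \<le> p + q}"
      using pq n mn by (auto simp: LamH1_def LamH2_def Lam_def)
    ultimately show ?thesis by simp
  qed
  finally show ?thesis by (simp add: c_def)
qed

text \<open>
Here the test function is the homogeneous polynomial with zero Cauchy jet whose Laplacian is, up to sign, the
divided monomial of order \<open>(m, n)\<close>.
\<close>

lemma AHf_top:
  assumes a: "smooth_upto x0 y0 a" and a0: "a x0 y0 \<noteq> 0"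
    and pq: "(p, q) \<in> LamH2 (M + 1)" and mn: "m + n + 2 = p + q"
  shows "AHf x0 y0 a M p q m n
    = (if q \<ge> n + 2 \<and> even (q - n) then (-1) ^ ((q - n) div 2) / a x0 y0 else 0)"
proof -
  define c :: "nat \<Rightarrow> nat \<Rightarrow> real" where
    "c i j = (if i + j = p + q \<and> j \<ge> n + 2 \<and> even (j - n) then (-1) ^ ((j - n) div 2) else 0)"
    for i j
  define u where "u = jet_poly x0 y0 (p + q) c"
  have u: "smooth_upto x0 y0 u" unfolding u_def by (rule jet_poly_smooth_upto)
  have jet: "pd y0 i j u x0 y0 = c i j" for i j
    unfolding u_def by (auto simp: pd_jet_poly c_def)
  have lap: "c (i + 2) j + c i (j + 2) = (if i = m \<and> j = n then -1 else 0)"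
    if "i + j + 2 \<le> p + q" for i j
  proof (cases "i + j + 2 = p + q \<and> j \<ge> n \<and> even (j - n)")
    case True
    then obtain l where l: "j = n + 2 * l" by (metis dvdE le_Suc_ex add_diff_cancel_left')
    have "(-1 :: real) ^ ((n + 2 * l + 2 - n) div 2) = - ((-1) ^ l)" by simp
    then show ?thesis using True mn l by (cases "l = 0") (auto simp: c_def)
  next
    case False
    then show ?thesis using that mn by (auto simp: c_def)
  qed
  have f: "pd y0 i j (source y0 a u) x0 y0 = (if i = m \<and> j = n then a x0 y0 else 0)"
    if "i + j + 2 \<le> p + q" for i j
  proof -
    have "pd y0 i j (source y0 a u) x0 y0 = - pd y0 0 0 a x0 y0 * (c (i + 2) j + c i (j + 2))"
      unfolding pd_source[OF a u] jet
      by (rule source_jet_leading[OF _ that]) (simp add: c_def)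
    then show ?thesis unfolding lap[OF that] by simp
  qed
  have "c p q = (\<Sum>(i, j)\<in>{(i, j) \<in> LamH1 (M + 1). i + j \<le> p + q}. AHu x0 y0 a M p q i j * c i j)
      + (\<Sum>(i, j)\<in>{(i, j) \<in> Lam (M - 1). i + j + 2 \<le> p + q}.
          AHf x0 y0 a M p q i j * pd y0 i j (source y0 a u) x0 y0)"
    using is_reduction_AH[OF a a0, of M, unfolded is_reduction_def] u pq jet by fastforce
  also have "(\<Sum>(i, j)\<in>{(i, j) \<in> LamH1 (M + 1). i + j \<le> p + q}. AHu x0 y0 a M p q i j * c i j) = 0"
    by (intro sum.neutral) (auto simp: c_def LamH1_def)
  also have "(\<Sum>(i, j)\<in>{(i, j) \<in> Lam (M - 1). i + j + 2 \<le> p + q}.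
          AHf x0 y0 a M p q i j * pd y0 i j (source y0 a u) x0 y0)
      = (\<Sum>z\<in>{(i, j) \<in> Lam (M - 1). i + j + 2 \<le> p + q}.
          if z = (m, n) then AHf x0 y0 a M p q m n * a x0 y0 else 0)"
    by (intro sum.cong) (auto simp: f split: if_splits)
  also have "\<dots> = AHf x0 y0 a M p q m n * a x0 y0"
  proof -
    have "finite {(i, j) \<in> Lam (M - 1). i + j + 2 \<le> p + q}"
      by (rule finite_subset[OF _ finite_Lam[of "M - 1"]]) auto
    moreover have "(m, n) \<in> {(i, j) \<in> Lam (M - 1). i + j + 2 \<le> p + q}"
      using pq mn by (auto simp: LamH2_def Lam_def)
    ultimately show ?thesis by simp
  qed
  finally have "AHf x0 y0 a M p q m n = c p q / a x0 y0" using a0 by simp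
  then show ?thesis by (auto simp: c_def)
qed

text \<open>
The coefficient of \<open>u^(m,n)\<close> in \<open>u^(p,q)\<close> after elimination, for all \<open>(p, q)\<close>, with the top order made
explicit.  For \<open>n \<le> 1\<close> the top order formula gives the Kronecker delta when \<open>q \<le> 1\<close>, so the derivatives that are
not eliminated fit in without a separate case.
\<close>

definition GH_coef ::
  "real \<Rightarrow> real \<Rightarrow> (real \<Rightarrow> real \<Rightarrow> real) \<Rightarrow> nat \<Rightarrow> nat \<Rightarrow> nat \<Rightarrow> nat \<Rightarrow> nat \<Rightarrow> real" where
  "GH_coef x0 y0 a M m n p q =
     (if p + q < m + n then 0
      else if p + q = m + n then (if even q = even n then (-1) ^ (q div 2) else 0)
      else if q \<le> 1 then 0 else AHu x0 y0 a M p q m n)"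

definition QH_coef ::
  "real \<Rightarrow> real \<Rightarrow> (real \<Rightarrow> real \<Rightarrow> real) \<Rightarrow> nat \<Rightarrow> nat \<Rightarrow> nat \<Rightarrow> nat \<Rightarrow> nat \<Rightarrow> real" where
  "QH_coef x0 y0 a M m n p q =
     (if p + q < m + n + 2 \<or> q \<le> 1 then 0
      else if p + q = m + n + 2 then
        (if q \<ge> n + 2 \<and> even (q - n) then (-1) ^ ((q - n) div 2) / a x0 y0 else 0)
      else AHf x0 y0 a M p q m n)"

lemma GH_monomials:
  assumes "m + n \<le> M + 1" and n: "n \<le> 1"
  shows "GH x0 y0 a M m n x y = (\<Sum>(p, q)\<in>Lam (M + 1). GH_coef x0 y0 a M m n p q * monomial p q x y)"
proof -
  let ?g = "\<lambda>(p, q). GH_coef x0 y0 a M m n p q * monomial p q x y"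
  let ?T = "{(p, q). p + q = m + n \<and> even q = even n}"
  let ?H = "{(p, q) \<in> LamH2 (M + 1). p + q > m + n}"
  have fin: "finite ?T" "finite ?H"
    by (rule finite_subset[OF _ finite_Lam[of "M + 1"]], use assms in \<open>auto simp: Lam_def LamH2_def\<close>)+
  have "sum ?g (Lam (M + 1)) = sum ?g (?T \<union> ?H)"
    by (rule sum.mono_neutral_right[OF finite_Lam])
       (use assms in \<open>auto simp: Lam_def LamH2_def LamH1_def GH_coef_def split: if_splits\<close>)
  also have "\<dots> = sum ?g ?T + sum ?g ?H"
    by (rule sum.union_disjoint[OF fin]) auto
  also have "sum ?g ?H = (\<Sum>(p, q)\<in>?H. AHu x0 y0 a M p q m n * (x ^ p * y ^ q / (fact p * fact q)))"
    by (intro sum.cong) (auto simp: GH_coef_def monomial_def LamH2_def LamH1_def Lam_def)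
  also have "sum ?g ?T = (\<Sum>l = 0..m div 2.
      (-1) ^ l * y ^ (n + 2 * l) * x ^ (m - 2 * l) / (fact (n + 2 * l) * fact (m - 2 * l)))"
  proof (rule sum.reindex_bij_witness[of _ "\<lambda>l. (m - 2 * l, n + 2 * l)" "\<lambda>(p, q). q div 2"])
    fix z assume "z \<in> ?T"
    then obtain p q where z: "z = (p, q)" "p + q = m + n" "even q = even n" by auto
    have q: "n + 2 * (q div 2) = q" using z(3) n by (cases "n = 0") (auto elim: oddE)
    show "(case z of (p, q) \<Rightarrow> q div 2) \<in> {0..m div 2}"
      "(m - 2 * (case z of (p, q) \<Rightarrow> q div 2), n + 2 * (case z of (p, q) \<Rightarrow> q div 2)) = z"
      using z q by auto
    have "m - 2 * (q div 2) = p" using q z(2) by linarith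
    then show "(-1) ^ (case z of (p, q) \<Rightarrow> q div 2) * y ^ (n + 2 * (case z of (p, q) \<Rightarrow> q div 2)) *
        x ^ (m - 2 * (case z of (p, q) \<Rightarrow> q div 2)) /
        (fact (n + 2 * (case z of (p, q) \<Rightarrow> q div 2)) * fact (m - 2 * (case z of (p, q) \<Rightarrow> q div 2)))
        = ?g z"
      using z q by (simp add: GH_coef_def monomial_def mult_ac)
  next
    fix l assume "l \<in> {0..m div 2}"
    then show "(m - 2 * l, n + 2 * l) \<in> ?T" "(case (m - 2 * l, n + 2 * l) of (p, q) \<Rightarrow> q div 2) = l"
      using n by auto
  qed
  finally show ?thesis by (simp add: GH_def)
qed

lemma QH_monomials:
  assumes "m + n + 1 \<le> M"
  shows "QH x0 y0 a M m n x y = (\<Sum>(p, q)\<in>Lam (M + 1). QH_coef x0 y0 a M m n p q * monomial p q x y)"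
proof -
  let ?g = "\<lambda>(p, q). QH_coef x0 y0 a M m n p q * monomial p q x y"
  let ?T = "{(p, q). p + q = m + n + 2 \<and> q \<ge> n + 2 \<and> even (q - n)}"
  let ?H = "{(p, q) \<in> LamH2 (M + 1). p + q > m + n + 2}"
  have fin: "finite ?T" "finite ?H"
    by (rule finite_subset[OF _ finite_Lam[of "M + 1"]], use assms in \<open>auto simp: Lam_def LamH2_def\<close>)+
  have "sum ?g (Lam (M + 1)) = sum ?g (?T \<union> ?H)"
    by (rule sum.mono_neutral_right[OF finite_Lam])
       (use assms in \<open>auto simp: Lam_def LamH2_def LamH1_def QH_coef_def split: if_splits\<close>)
  also have "\<dots> = sum ?g ?T + sum ?g ?H"
    by (rule sum.union_disjoint[OF fin]) auto
  also have "sum ?g ?H = (\<Sum>(p, q)\<in>?H. AHf x0 y0 a M p q m n * (x ^ p * y ^ q / (fact p * fact q)))"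
    by (intro sum.cong) (auto simp: QH_coef_def monomial_def LamH2_def LamH1_def Lam_def)
  also have "sum ?g ?T = (\<Sum>l = 1..1 + m div 2. 1 / a x0 y0 *
      ((-1) ^ l * y ^ (n + 2 * l) * x ^ (m + 2 - 2 * l) / (fact (n + 2 * l) * fact (m + 2 - 2 * l))))"
  proof (rule sum.reindex_bij_witness[of _ "\<lambda>l. (m + 2 - 2 * l, n + 2 * l)" "\<lambda>(p, q). (q - n) div 2"])
    fix z assume "z \<in> ?T"
    then obtain p q where z: "z = (p, q)" "p + q = m + n + 2" "q \<ge> n + 2" "even (q - n)" by auto
    have q: "n + 2 * ((q - n) div 2) = q" using z(3,4) by auto
    show "(case z of (p, q) \<Rightarrow> (q - n) div 2) \<in> {1..1 + m div 2}"
      "(m + 2 - 2 * (case z of (p, q) \<Rightarrow> (q - n) div 2),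
        n + 2 * (case z of (p, q) \<Rightarrow> (q - n) div 2)) = z"
      using z q by auto
    have "m + 2 - 2 * ((q - n) div 2) = p" using q z(2) by linarith
    then show "1 / a x0 y0 * ((-1) ^ (case z of (p, q) \<Rightarrow> (q - n) div 2) *
        y ^ (n + 2 * (case z of (p, q) \<Rightarrow> (q - n) div 2)) *
        x ^ (m + 2 - 2 * (case z of (p, q) \<Rightarrow> (q - n) div 2)) /
        (fact (n + 2 * (case z of (p, q) \<Rightarrow> (q - n) div 2)) *
         fact (m + 2 - 2 * (case z of (p, q) \<Rightarrow> (q - n) div 2)))) = ?g z"
      using z q by (simp add: QH_coef_def monomial_def mult_ac)
  next
    fix l assume "l \<in> {1..1 + m div 2}"
    then show "(m + 2 - 2 * l, n + 2 * l) \<in> ?T"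
      "(case (m + 2 - 2 * l, n + 2 * l) of (p, q) \<Rightarrow> (q - n) div 2) = l"
      by auto
  qed
  finally show ?thesis by (simp only: QH_def sum_distrib_left)
qed

text \<open>
The defining identity of the elimination, extended to all derivatives up to order \<open>M + 1\<close>.
\<close>

lemma jet_reduction:
  assumes a: "smooth_upto x0 y0 a" and a0: "a x0 y0 \<noteq> 0" and u: "smooth_upto x0 y0 u"
    and pq: "p + q \<le> M + 1" and "M \<ge> 1"
  shows "pd y0 p q u x0 y0
    = (\<Sum>(m, n)\<in>LamH1 (M + 1). GH_coef x0 y0 a M m n p q * pd y0 m n u x0 y0)
    + (\<Sum>(m, n)\<in>Lam (M - 1). QH_coef x0 y0 a M m n p q * pd y0 m n (source y0 a u) x0 y0)"
proof (cases "q \<le> 1")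
  case True
  have "(\<Sum>(m, n)\<in>LamH1 (M + 1). GH_coef x0 y0 a M m n p q * pd y0 m n u x0 y0)
      = (\<Sum>(m, n)\<in>LamH1 (M + 1). (if m = p \<and> n = q then 1 else 0) * pd y0 m n u x0 y0)"
    using True by (intro sum.cong) (auto simp: GH_coef_def LamH1_def le_Suc_eq)
  also have "\<dots> = pd y0 p q u x0 y0"
    using True pq by (intro sum_kronecker_pair[OF finite_LamH1]) (auto simp: LamH1_def Lam_def)
  finally show ?thesis using True by (simp add: QH_coef_def)
next
  case False
  then have mem: "(p, q) \<in> LamH2 (M + 1)" using pq by (auto simp: LamH2_def LamH1_def Lam_def)
  have "pd y0 p q u x0 y0
    = (\<Sum>(m, n)\<in>{(m, n) \<in> LamH1 (M + 1). m + n \<le> p + q}. AHu x0 y0 a M p q m n * pd y0 m n u x0 y0)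
      + (\<Sum>(m, n)\<in>{(m, n) \<in> Lam (M - 1). m + n + 2 \<le> p + q}.
          AHf x0 y0 a M p q m n * pd y0 m n (source y0 a u) x0 y0)"
    using is_reduction_AH[OF a a0, of M, unfolded is_reduction_def] u mem by fastforce
  also have "(\<Sum>(m, n)\<in>{(m, n) \<in> LamH1 (M + 1). m + n \<le> p + q}. AHu x0 y0 a M p q m n * pd y0 m n u x0 y0)
      = (\<Sum>(m, n)\<in>LamH1 (M + 1). GH_coef x0 y0 a M m n p q * pd y0 m n u x0 y0)"
  proof (rule sum.mono_neutral_cong_left[OF finite_LamH1]; clarify?)
    fix m n assume "(m, n) \<in> LamH1 (M + 1)" "m + n \<le> p + q"
    moreover from this have "n \<le> 1" by (auto simp: LamH1_def)
    ultimately show "AHu x0 y0 a M p q m n * pd y0 m n u x0 y0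
        = GH_coef x0 y0 a M m n p q * pd y0 m n u x0 y0"
      using AHu_top[OF a a0 mem, of n m] False by (auto simp: GH_coef_def)
  qed (auto simp: GH_coef_def split: if_splits)
  also have "(\<Sum>(m, n)\<in>{(m, n) \<in> Lam (M - 1). m + n + 2 \<le> p + q}.
          AHf x0 y0 a M p q m n * pd y0 m n (source y0 a u) x0 y0)
      = (\<Sum>(m, n)\<in>Lam (M - 1). QH_coef x0 y0 a M m n p q * pd y0 m n (source y0 a u) x0 y0)"
  proof (rule sum.mono_neutral_cong_left[OF finite_Lam]; clarify?)
    fix m n assume "(m, n) \<in> Lam (M - 1)" "m + n + 2 \<le> p + q"
    then show "AHf x0 y0 a M p q m n * pd y0 m n (source y0 a u) x0 y0
        = QH_coef x0 y0 a M m n p q * pd y0 m n (source y0 a u) x0 y0"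
      using AHf_top[OF a a0 mem, of m n] False by (auto simp: QH_coef_def)
  qed (auto simp: QH_coef_def split: if_splits)
  finally show ?thesis .
qed

text \<open>
Each derivative in the Taylor polynomial is replaced by its reduction, and the order of summation is
exchanged.
\<close>

lemma taylor_polynomial_GH_QH:
  assumes a: "smooth_upto x0 y0 a" and a0: "a x0 y0 \<noteq> 0" and u: "smooth_upto x0 y0 u"
    and M: "M \<ge> 1"
  shows "(\<Sum>(p, q)\<in>Lam (M + 1). pd y0 p q u x0 y0 * monomial p q x y)
    = (\<Sum>(m, n)\<in>LamH1 (M + 1). pd y0 m n u x0 y0 * GH x0 y0 a M m n x y)
    + (\<Sum>(m, n)\<in>Lam (M - 1). pd y0 m n (source y0 a u) x0 y0 * QH x0 y0 a M m n x y)"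
proof -
  have "(\<Sum>(p, q)\<in>Lam (M + 1). pd y0 p q u x0 y0 * monomial p q x y)
    = (\<Sum>(p, q)\<in>Lam (M + 1). \<Sum>(m, n)\<in>LamH1 (M + 1).
        pd y0 m n u x0 y0 * (GH_coef x0 y0 a M m n p q * monomial p q x y))
    + (\<Sum>(p, q)\<in>Lam (M + 1). \<Sum>(m, n)\<in>Lam (M - 1).
        pd y0 m n (source y0 a u) x0 y0 * (QH_coef x0 y0 a M m n p q * monomial p q x y))"
    unfolding sum.distrib[symmetric] split_beta
  proof (intro sum.cong refl)
    fix z assume "z \<in> Lam (M + 1)"
    then have "fst z + snd z \<le> M + 1" by (auto simp: Lam_def)
    from jet_reduction[OF a a0 u this M]
    show "pd y0 (fst z) (snd z) u x0 y0 * monomial (fst z) (snd z) x y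
      = (\<Sum>w\<in>LamH1 (M + 1). pd y0 (fst w) (snd w) u x0 y0 *
          (GH_coef x0 y0 a M (fst w) (snd w) (fst z) (snd z) * monomial (fst z) (snd z) x y))
      + (\<Sum>w\<in>Lam (M - 1). pd y0 (fst w) (snd w) (source y0 a u) x0 y0 *
          (QH_coef x0 y0 a M (fst w) (snd w) (fst z) (snd z) * monomial (fst z) (snd z) x y))"
      by (simp add: split_beta distrib_left sum_distrib_left mult_ac)
  qed
  also have "\<dots> = (\<Sum>(m, n)\<in>LamH1 (M + 1). pd y0 m n u x0 y0 * GH x0 y0 a M m n x y)
    + (\<Sum>(m, n)\<in>Lam (M - 1). pd y0 m n (source y0 a u) x0 y0 * QH x0 y0 a M m n x y)"
  proof (intro arg_cong2[of _ _ _ _ "(+)"])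
    show "(\<Sum>(p, q)\<in>Lam (M + 1). \<Sum>(m, n)\<in>LamH1 (M + 1).
        pd y0 m n u x0 y0 * (GH_coef x0 y0 a M m n p q * monomial p q x y))
      = (\<Sum>(m, n)\<in>LamH1 (M + 1). pd y0 m n u x0 y0 * GH x0 y0 a M m n x y)"
      unfolding split_beta
      by (subst sum.swap, intro sum.cong refl, subst GH_monomials)
         (auto simp: LamH1_def Lam_def sum_distrib_left split_beta)
    show "(\<Sum>(p, q)\<in>Lam (M + 1). \<Sum>(m, n)\<in>Lam (M - 1).
        pd y0 m n (source y0 a u) x0 y0 * (QH_coef x0 y0 a M m n p q * monomial p q x y))
      = (\<Sum>(m, n)\<in>Lam (M - 1). pd y0 m n (source y0 a u) x0 y0 * QH x0 y0 a M m n x y)"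
      unfolding split_beta
      by (subst sum.swap, intro sum.cong refl, subst QH_monomials)
         (use M in \<open>auto simp: Lam_def sum_distrib_left split_beta\<close>)
  qed
  finally show ?thesis .
qed

section \<open>Accuracy of the scheme\<close>

lemma poly_bigo_1: "(\<lambda>h. poly P h) \<in> O[at_right 0](\<lambda>_. 1 :: real)" for P :: "real poly"
proof (rule bigoI_tendsto[where c = "poly P 0"])
  show "((\<lambda>h. poly P h / 1) \<longlongrightarrow> poly P 0) (at_right 0)"
    by (auto intro!: tendsto_eq_intros)
qed simp

lemma stencil_sum_bigo:
  assumes "\<And>k l. l \<le> 0 \<Longrightarrow> (\<lambda>h. w h (of_int k * h) (of_int l * h)) \<in> O[at_right 0](g)"
  shows "(\<lambda>h. stencil_sum C (w h) h) \<in> O[at_right 0](g)"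
  unfolding stencil_sum_def
proof (intro big_sum_in_bigo)
  fix k l :: int assume "l \<in> {-1..0}"
  then have "(\<lambda>h. w h (of_int k * h) (of_int l * h)) \<in> O[at_right 0](g)"
    by (intro assms) auto
  from landau_o.big.mult[OF poly_bigo_1 this, of "C k l"]
  show "(\<lambda>h. poly (C k l) h * w h (of_int k * h) (of_int l * h)) \<in> O[at_right 0](g)"
    by simp
qed

lemma stencil_sum_add:
  "stencil_sum C (\<lambda>x y. v x y + w x y) h = stencil_sum C v h + stencil_sum C w h"
  by (simp add: stencil_sum_def distrib_left sum.distrib)

lemma stencil_sum_diff:
  "stencil_sum C (\<lambda>x y. v x y - w x y) h = stencil_sum C v h - stencil_sum C w h"
  by (simp add: stencil_sum_def right_diff_distrib sum_subtractf)

lemma stencil_sum_lincomb: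
  "stencil_sum C (\<lambda>x y. \<Sum>i\<in>S. c i * w i x y) h = (\<Sum>i\<in>S. c i * stencil_sum C (w i) h)"
proof -
  have "stencil_sum C (\<lambda>x y. \<Sum>i\<in>S. c i * w i x y) h = (\<Sum>k\<in>{-1..1}. \<Sum>l\<in>{-1..0}. \<Sum>i\<in>S.
      c i * (poly (C k l) h * w i (of_int k * h) (of_int l * h)))"
    by (simp add: stencil_sum_def sum_distrib_left mult_ac)
  also have "\<dots> = (\<Sum>i\<in>S. \<Sum>k\<in>{-1..1}. \<Sum>l\<in>{-1..0}.
      c i * (poly (C k l) h * w i (of_int k * h) (of_int l * h)))"
    by (simp only: sum.swap[of _ S])
  finally show ?thesis by (simp add: stencil_sum_def sum_distrib_left)
qed

text \<open>
What multiplies \<open>u^(n,0)\<close> in the Taylor polynomial once the \<open>u^(i,1)\<close> have been replaced by means of the boundary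
condition.
\<close>

definition boundary_kernel ::
  "real \<Rightarrow> real \<Rightarrow> (real \<Rightarrow> real \<Rightarrow> real) \<Rightarrow> (real \<Rightarrow> real) \<Rightarrow> nat \<Rightarrow> nat \<Rightarrow> real \<Rightarrow> real \<Rightarrow> real" where
  "boundary_kernel x0 y0 a b M n x y = GH x0 y0 a M n 0 x y
     - (\<Sum>i = n..M. real (i choose n) * (deriv ^^ (i - n)) b x0 * GH x0 y0 a M i 1 x y)"

lemma sum_LamH1:
  fixes f :: "nat \<Rightarrow> nat \<Rightarrow> real"
  shows "(\<Sum>(m, n)\<in>LamH1 (Suc M). f m n) = (\<Sum>m\<le>Suc M. f m 0) + (\<Sum>m\<le>M. f m 1)"
proof -
  have "LamH1 (Suc M) = (\<lambda>m. (m, 0)) ` {..Suc M} \<union> (\<lambda>m. (m, 1)) ` {..M}"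
    by (auto simp: LamH1_def Lam_def)
  moreover have "(\<Sum>(m, n)\<in>(\<lambda>m. (m, 0)) ` {..Suc M} \<union> (\<lambda>m. (m, 1)) ` {..M}. f m n)
      = (\<Sum>(m, n)\<in>(\<lambda>m. (m, 0)) ` {..Suc M}. f m n) + (\<Sum>(m, n)\<in>(\<lambda>m. (m, 1)) ` {..M}. f m n)"
    by (rule sum.union_disjoint) auto
  ultimately show ?thesis
    by (simp add: sum.reindex inj_on_def del: sum.atMost_Suc)
qed

lemma taylor_polynomial_boundary:
  assumes a: "smooth_upto x0 y0 a" and a0: "a x0 y0 \<noteq> 0" and b: "smooth_at x0 b"
    and u: "smooth_upto x0 y0 u" and M: "M \<ge> 1"
  shows "(\<Sum>(p, q)\<in>Lam (Suc M). pd y0 p q u x0 y0 * monomial p q x y)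
    = (\<Sum>n\<le>Suc M. pd y0 n 0 u x0 y0 * boundary_kernel x0 y0 a b M n x y)
    + ((\<Sum>(m, n)\<in>Lam (M - 1). pd y0 m n (source y0 a u) x0 y0 * QH x0 y0 a M m n x y)
    + (\<Sum>n\<in>{0..M}. (deriv ^^ n) (boundary_data y0 b u) x0 * GH x0 y0 a M n 1 x y))"
proof -
  let ?v = "\<lambda>n. pd y0 n 0 u x0 y0" and ?G = "GH x0 y0 a M"
  let ?b = "\<lambda>n. (deriv ^^ n) b x0" and ?g = "\<lambda>n. (deriv ^^ n) (boundary_data y0 b u) x0"
  have "(\<Sum>m\<le>M. pd y0 m 1 u x0 y0 * ?G m 1 x y) = (\<Sum>m\<le>M. ?g m * ?G m 1 x y)
      - (\<Sum>m\<le>M. \<Sum>i\<le>m. ?v i * (real (m choose i) * ?b (m - i) * ?G m 1 x y))"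
    unfolding deriv_boundary_data[OF b u] sum_subtractf[symmetric]
    by (intro sum.cong) (simp_all add: distrib_left sum_distrib_left mult_ac)
  also have "(\<Sum>m\<le>M. \<Sum>i\<le>m. ?v i * (real (m choose i) * ?b (m - i) * ?G m 1 x y))
      = (\<Sum>m\<le>M. \<Sum>i | i \<in> {..M} \<and> i \<le> m. ?v i * (real (m choose i) * ?b (m - i) * ?G m 1 x y))"
    by (intro sum.cong) auto
  also have "\<dots> = (\<Sum>i\<le>M. \<Sum>m | m \<in> {..M} \<and> i \<le> m. ?v i * (real (m choose i) * ?b (m - i) * ?G m 1 x y))"
    by (rule sum.swap_restrict) auto
  also have "\<dots> = (\<Sum>i\<le>M. ?v i * (\<Sum>m = i..M. real (m choose i) * ?b (m - i) * ?G m 1 x y))"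
    unfolding sum_distrib_left by (intro sum.cong) auto
  also have "\<dots> = (\<Sum>i\<le>Suc M. ?v i * (\<Sum>m = i..M. real (m choose i) * ?b (m - i) * ?G m 1 x y))"
    by simp
  finally have *: "(\<Sum>m\<le>M. pd y0 m 1 u x0 y0 * ?G m 1 x y) = (\<Sum>m\<le>M. ?g m * ?G m 1 x y)
      - (\<Sum>i\<le>Suc M. ?v i * (\<Sum>m = i..M. real (m choose i) * ?b (m - i) * ?G m 1 x y))" .
  have "(\<Sum>n\<le>Suc M. ?v n * boundary_kernel x0 y0 a b M n x y) = (\<Sum>n\<le>Suc M. ?v n * ?G n 0 x y)
      - (\<Sum>i\<le>Suc M. ?v i * (\<Sum>m = i..M. real (m choose i) * ?b (m - i) * ?G m 1 x y))"
    unfolding boundary_kernel_def right_diff_distrib sum_subtractf ..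
  with * show ?thesis
    using taylor_polynomial_GH_QH[OF a a0 u M, of x y]
    by (simp add: sum_LamH1 atLeast0AtMost del: sum.atMost_Suc)
qed

text \<open>
The difference of the two sides of the scheme is the stencil applied to the Taylor remainder plus the residuals
of the linear system weighted with \<open>u^(n,0)\<close>; stencil coefficients are bounded near \<open>h = 0\<close>.
\<close>

lemma scheme_accuracy:
  assumes a: "smooth_upto x0 y0 a" and a0: "a x0 y0 \<noteq> 0" and b: "smooth_at x0 b"
    and C: "nontrivial C" and M: "M \<ge> 1"
    and sys: "\<And>n. n \<le> Suc M \<Longrightarrow>
      (\<lambda>h. stencil_sum C (boundary_kernel x0 y0 a b M n) h) \<in> O[at_right 0](\<lambda>h. h ^ (M + 2))"
  shows "has_accuracy_order x0 y0 a b C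
      (Lam (M - 1)) (\<lambda>m n h. stencil_sum C (QH x0 y0 a M m n) h)
      {0..M} (\<lambda>n h. stencil_sum C (GH x0 y0 a M n 1) h) (M + 1)"
  unfolding has_accuracy_order_def
proof (intro conjI allI impI)
  fix u assume u: "smooth_upto x0 y0 u"
  let ?T = "\<lambda>x y. \<Sum>(p, q)\<in>Lam (Suc M). pd y0 p q u x0 y0 * monomial p q x y"
  have "(\<lambda>h. stencil_sum C (\<lambda>x y. u (x0 + x) (y0 + y) - ?T x y) h) \<in> O[at_right 0](\<lambda>h. h ^ (M + 2))"
    using taylor_half_nbhd[OF u, of _ _ "Suc M"] by (intro stencil_sum_bigo) simp
  moreover have "(\<lambda>h. \<Sum>n\<le>Suc M. pd y0 n 0 u x0 y0 * stencil_sum C (boundary_kernel x0 y0 a b M n) h)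
      \<in> O[at_right 0](\<lambda>h. h ^ (M + 2))"
    using sys by (intro big_sum_in_bigo) (auto simp: landau_o.big.cmult_in_iff)
  ultimately have "(\<lambda>h. stencil_sum C (\<lambda>x y. u (x0 + x) (y0 + y) - ?T x y) h
      + (\<Sum>n\<le>Suc M. pd y0 n 0 u x0 y0 * stencil_sum C (boundary_kernel x0 y0 a b M n) h))
      \<in> O[at_right 0](\<lambda>h. h ^ (M + 2))"
    by (rule sum_in_bigo)
  moreover have "stencil_sum C ?T h
      = (\<Sum>n\<le>Suc M. pd y0 n 0 u x0 y0 * stencil_sum C (boundary_kernel x0 y0 a b M n) h)
      + ((\<Sum>(m, n)\<in>Lam (M - 1). pd y0 m n (source y0 a u) x0 y0 * stencil_sum C (QH x0 y0 a M m n) h)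
      + (\<Sum>n\<in>{0..M}. (deriv ^^ n) (boundary_data y0 b u) x0 * stencil_sum C (GH x0 y0 a M n 1) h))"
    for h
    unfolding taylor_polynomial_boundary[OF a a0 b u M] split_beta
    by (simp only: stencil_sum_add stencil_sum_lincomb)
  moreover have diff_add_middle: "r - (s + t) + s = r - t" for r s t :: real by simp
  ultimately show "(\<lambda>h. stencil_sum C (\<lambda>x y. u (x0 + x) (y0 + y)) h -
      ((\<Sum>(m, n)\<in>Lam (M - 1). pd y0 m n (source y0 a u) x0 y0 * stencil_sum C (QH x0 y0 a M m n) h) +
       (\<Sum>n\<in>{0..M}. (deriv ^^ n) (boundary_data y0 b u) x0 * stencil_sum C (GH x0 y0 a M n 1) h)))
      \<in> O[at_right 0](\<lambda>h. h ^ (M + 1 + 1))"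
    by (simp only: stencil_sum_diff add.assoc one_add_one diff_add_middle)
qed (use C in auto)

section \<open>Existence of a sixth order scheme\<close>

definition boundary_coef ::
  "real \<Rightarrow> real \<Rightarrow> (real \<Rightarrow> real \<Rightarrow> real) \<Rightarrow> (real \<Rightarrow> real) \<Rightarrow> nat \<Rightarrow> nat \<Rightarrow> nat \<Rightarrow> nat \<Rightarrow> real" where
  "boundary_coef x0 y0 a b M n p q = GH_coef x0 y0 a M n 0 p q
     - (\<Sum>i = n..M. real (i choose n) * (deriv ^^ (i - n)) b x0 * GH_coef x0 y0 a M i 1 p q)"

lemma boundary_kernel_monomials:
  assumes "n \<le> Suc M"
  shows "boundary_kernel x0 y0 a b M n x y = (\<Sum>(p, q)\<in>Lam (Suc M). boundary_coef x0 y0 a b M n p q * monomial p q x y)"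
proof -
  have "(\<Sum>i = n..M. real (i choose n) * (deriv ^^ (i - n)) b x0 * GH x0 y0 a M i 1 x y)
      = (\<Sum>i = n..M. real (i choose n) * (deriv ^^ (i - n)) b x0 *
          (\<Sum>(p, q)\<in>Lam (Suc M). GH_coef x0 y0 a M i 1 p q * monomial p q x y))"
    by (intro sum.cong) (simp_all add: GH_monomials)
  also have "\<dots> = (\<Sum>(p, q)\<in>Lam (Suc M). (\<Sum>i = n..M. real (i choose n) * (deriv ^^ (i - n)) b x0 *
      GH_coef x0 y0 a M i 1 p q) * monomial p q x y)"
    unfolding sum_distrib_left sum_distrib_right split_beta
    by (subst sum.swap) (simp add: mult_ac)
  finally show ?thesis
    using GH_monomials[of n 0 M x0 y0 a x y] assms
    by (simp add: boundary_kernel_def boundary_coef_def left_diff_distrib sum_subtractf split_beta)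
qed

lemma boundary_coef_low: "p + q < n \<Longrightarrow> boundary_coef x0 y0 a b M n p q = 0"
  by (simp add: boundary_coef_def GH_coef_def)

text \<open>
The lowest part of the \<open>n\<close>-th kernel satisfies the leading parts of the equation and of the boundary condition,
which are Laplace's equation and \<open>u\<^sub>y = 0\<close>; it is the harmonic polynomial \<open>Re (x + i y)^n / n!\<close>.
\<close>

lemma boundary_coef_leading:
  "p + q = n \<Longrightarrow> boundary_coef x0 y0 a b M n p q = (if even q then (-1) ^ (q div 2) else 0)"
  by (simp add: boundary_coef_def GH_coef_def)

text \<open>
Up to degree \<open>n + 1\<close> the kernel is the solution of the homogeneous equation and the homogeneous boundary
condition with \<open>u = x^n / n!\<close> on the boundary.  With \<open>P n = Re z^n / n!\<close>, \<open>A = a\<^sub>x / a\<close> and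
\<open>B = a\<^sub>y / a\<close>, its part of degree \<open>n + 1\<close> is
\<open>- (A x + B y) / 2 * P n + A (n + 1) / 2 * P (n + 1) + (B / 2 - \<beta>) * Im z^(n+1) / (n + 1)!\<close>, where the
first term is the first-order effect of multiplying a harmonic function by \<open>1 / sqrt a\<close> and the others restore the boundary
values.  The formula in the lemma lists its coefficients; it is
proved by applying the reduction to the polynomial with these jets.
\<close>

lemma boundary_coef_subleading:
  assumes a: "smooth_upto x0 y0 a" and a0: "a x0 y0 \<noteq> 0"
    and n: "n \<le> M" "M \<ge> 1" and pq: "p + q = Suc n"
  shows "boundary_coef x0 y0 a b M n p q = (-1) ^ (q div 2) *
    (if even q then pd y0 1 0 a x0 y0 / a x0 y0 * real (q div 2)
     else - pd y0 0 1 a x0 y0 / a x0 y0 * real (q div 2) - b x0)"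
proof -
  define A B where "A = pd y0 1 0 a x0 y0 / a x0 y0" and "B = pd y0 0 1 a x0 y0 / a x0 y0"
  define c where "c i j = (if i + j = n then (if even j then (-1) ^ (j div 2) else 0)
      else if i + j = Suc n then
        (-1) ^ (j div 2) * (if even j then A * real (j div 2) else - B * real (j div 2) - b x0)
      else 0)" for i j :: nat
  define u where "u = jet_poly x0 y0 (Suc n) c"
  have u: "smooth_upto x0 y0 u" unfolding u_def by (rule jet_poly_smooth_upto)
  have jet: "pd y0 i j u x0 y0 = c i j" for i j
    unfolding u_def by (auto simp: pd_jet_poly c_def)
  have A: "a x0 y0 * A = pd y0 1 0 a x0 y0" and B: "a x0 y0 * B = pd y0 0 1 a x0 y0"
    using a0 by (simp_all add: A_def B_def)
  have f: "pd y0 i j (source y0 a u) x0 y0 = 0" if ij: "i + j + 2 \<le> Suc n" for i j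
  proof (cases "i + j + 2 \<le> n")
    case True
    then show ?thesis unfolding pd_source[OF a u] jet
      by (subst source_jet_leading[OF _ True]) (auto simp: c_def)
  next
    case False
    with ij have n: "i + j + 1 = n" by simp
    show ?thesis unfolding pd_source[OF a u] jet
    proof (subst source_jet_subleading[OF _ n], simp add: c_def, unfold pd_0_0 A[symmetric] B[symmetric])
      obtain l where "j = 2 * l \<or> j = 2 * l + 1" by (metis evenE oddE)
      then show "- (a x0 y0 * (c (i + 2) j + c i (j + 2))
          + a x0 y0 * A * (real (i + 1) * c (i + 1) j + (if i = 0 then 0 else real i * c (i - 1) (j + 2)))
          + a x0 y0 * B * ((if j = 0 then 0 else real j * c (i + 2) (j - 1)) + real (j + 1) * c i (j + 1)))
          = 0"
        using n by (cases i) (auto simp: c_def algebra_simps)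
    qed
  qed
  have "c p q = (\<Sum>(i, j)\<in>LamH1 (Suc M). GH_coef x0 y0 a M i j p q * c i j)
      + (\<Sum>(i, j)\<in>Lam (M - 1). QH_coef x0 y0 a M i j p q * pd y0 i j (source y0 a u) x0 y0)"
    using jet_reduction[OF a a0 u, of p q M] pq n unfolding jet by simp
  also have "(\<Sum>(i, j)\<in>Lam (M - 1). QH_coef x0 y0 a M i j p q * pd y0 i j (source y0 a u) x0 y0) = 0"
  proof (intro sum.neutral ballI)
    fix z assume "z \<in> Lam (M - 1)"
    show "(case z of (i, j) \<Rightarrow> QH_coef x0 y0 a M i j p q * pd y0 i j (source y0 a u) x0 y0) = 0"
      using f[of "fst z" "snd z"] pq by (cases "fst z + snd z + 2 \<le> Suc n") (auto simp: QH_coef_def split_beta)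
  qed
  also have "(\<Sum>(i, j)\<in>LamH1 (Suc M). GH_coef x0 y0 a M i j p q * c i j)
      = (\<Sum>i\<le>Suc M. GH_coef x0 y0 a M i 0 p q * c i 0) + (\<Sum>i\<le>M. GH_coef x0 y0 a M i 1 p q * c i 1)"
    by (rule sum_LamH1)
  also have "(\<Sum>i\<le>Suc M. GH_coef x0 y0 a M i 0 p q * c i 0)
      = (\<Sum>i\<le>Suc M. if i = n then GH_coef x0 y0 a M n 0 p q else 0)"
    by (intro sum.cong) (auto simp: c_def)
  also have "\<dots> = GH_coef x0 y0 a M n 0 p q" using n by simp
  also have "(\<Sum>i\<le>M. GH_coef x0 y0 a M i 1 p q * c i 1)
      = (\<Sum>i\<le>M. if i = n then - b x0 * GH_coef x0 y0 a M n 1 p q else 0)"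
    by (intro sum.cong) (auto simp: c_def)
  also have "\<dots> = - b x0 * GH_coef x0 y0 a M n 1 p q" using n by simp
  finally have "c p q = GH_coef x0 y0 a M n 0 p q - b x0 * GH_coef x0 y0 a M n 1 p q" by simp
  moreover have "(\<Sum>i = n..M. real (i choose n) * (deriv ^^ (i - n)) b x0 * GH_coef x0 y0 a M i 1 p q)
      = b x0 * GH_coef x0 y0 a M n 1 p q"
    using n pq by (subst sum.atLeast_Suc_atMost) (auto intro!: sum.neutral simp: GH_coef_def)
  ultimately have "boundary_coef x0 y0 a b M n p q = c p q" by (simp add: boundary_coef_def)
  then show ?thesis using pq by (simp add: c_def A_def B_def)
qed

text \<open>
\<open>Re (x + i y)^n / n!\<close>
\<close>

definition harm_re :: "nat \<Rightarrow> real \<Rightarrow> real \<Rightarrow> real" where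
  "harm_re n x y = (\<Sum>q\<le>n. if even q then (-1) ^ (q div 2) * monomial (n - q) q x y else 0)"

text \<open>
\<open>Im (x + i y)^n / n!\<close>
\<close>

definition harm_im :: "nat \<Rightarrow> real \<Rightarrow> real \<Rightarrow> real" where
  "harm_im n x y = (\<Sum>q\<le>n. if odd q then (-1) ^ (q div 2) * monomial (n - q) q x y else 0)"

definition stencil_pairing :: "(int \<Rightarrow> int \<Rightarrow> real) \<Rightarrow> (real \<Rightarrow> real \<Rightarrow> real) \<Rightarrow> real" where
  "stencil_pairing w f = (\<Sum>k\<in>{-1..1}. \<Sum>l\<in>{-1..0}. w k l * f (of_int k) (of_int l))"

lemma stencil_pairing_points:
  "stencil_pairing w f = w (-1) (-1) * f (-1) (-1) + w (-1) 0 * f (-1) 0 + w 0 (-1) * f 0 (-1)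
    + w 0 0 * f 0 0 + w 1 (-1) * f 1 (-1) + w 1 0 * f 1 0"
proof -
  have "{-1..1} = {-1, 0, 1 :: int}" "{-1..0} = {-1, 0 :: int}" by auto
  then show ?thesis by (simp add: stencil_pairing_def)
qed

lemma stencil_sum_pairing: "stencil_sum C w h = stencil_pairing (\<lambda>k l. poly (C k l) h) (\<lambda>k l. w (k * h) (l * h))"
  by (simp add: stencil_sum_def stencil_pairing_def)

lemma sum_atMost_numeral:
  "sum f {..numeral v} = sum f {..pred_numeral v} + f (numeral v)" for f :: "nat \<Rightarrow> real"
  by (simp add: numeral_eq_Suc)

lemmas harm_values = harm_re_def harm_im_def monomial_def stencil_pairing_points
  sum_atMost_numeral fact_numeral

text \<open>
The sums and differences of the weights at \<open>k = 1\<close> and \<open>k = -1\<close> are kept together: even \<open>n\<close> only see the former,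
odd \<open>n\<close> only the latter.
\<close>

lemma pairing_harm_re:
  "stencil_pairing w (harm_re 0) = w 0 0 + (w 1 0 + w (-1) 0) + w 0 (-1) + (w 1 (-1) + w (-1) (-1))"
  "stencil_pairing w (harm_re 1) = (w 1 0 - w (-1) 0) + (w 1 (-1) - w (-1) (-1))"
  "2 * stencil_pairing w (harm_re 2) = (w 1 0 + w (-1) 0) - w 0 (-1)"
  "6 * stencil_pairing w (harm_re 3) = (w 1 0 - w (-1) 0) - 2 * (w 1 (-1) - w (-1) (-1))"
  "24 * stencil_pairing w (harm_re 4)
     = (w 1 0 + w (-1) 0) + w 0 (-1) - 4 * (w 1 (-1) + w (-1) (-1))"
  "120 * stencil_pairing w (harm_re 5) = (w 1 0 - w (-1) 0) - 4 * (w 1 (-1) - w (-1) (-1))"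
  "720 * stencil_pairing w (harm_re 6) = (w 1 0 + w (-1) 0) - w 0 (-1)"
  by (simp_all add: harm_values field_simps)

lemma pairing_harm_im:
  "6 * stencil_pairing w (harm_im 3) = w 0 (-1) - 2 * (w 1 (-1) + w (-1) (-1))"
  "5040 * stencil_pairing w (harm_im 7) = w 0 (-1) + 8 * (w 1 (-1) + w (-1) (-1))"
  by (simp_all add: harm_values field_simps)

text \<open>
The three equations with odd \<open>n\<close> contain only the two differences \<open>w 1 l - w (-1) l\<close>.  The hypothesis is the linear
relation between their left-hand sides \<open>r\<^sub>n\<close>, namely \<open>2 * 1! r\<^sub>1 - 5 * 3! r\<^sub>3 + 3 * 5! r\<^sub>5 = 0\<close>.  The three equations
with even \<open>n\<close> are independent and contain four unknowns, of which \<open>w 0 (-1)\<close> is set to \<open>0\<close>.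
\<close>

lemma harmonic_interpolation:
  fixes r :: "nat \<Rightarrow> real"
  assumes "2 * r 1 - 30 * r 3 + 360 * r 5 = 0"
  shows "\<exists>w. \<forall>n\<le>5. stencil_pairing w (harm_re n) = r n"
proof -
  define s1 s2 t2 t1 where "s1 = r 2" and "s2 = (2 * r 2 - 24 * r 4) / 8"
    and "t2 = (r 1 - 6 * r 3) / 6" and "t1 = r 1 / 2 - (r 1 - 6 * r 3) / 6"
  define w :: "int \<Rightarrow> int \<Rightarrow> real" where
    "w k l = (if l = 0 then if k = 0 then r 0 - 2 * s1 - 2 * s2 else s1 + of_int k * t1
       else if k = 0 then 0 else s2 + of_int k * t2)" for k l
  have "stencil_pairing w (harm_re n) = r n" if "n \<le> 5" for n
  proof -
    have "n = 0 \<or> n = 1 \<or> n = 2 \<or> n = 3 \<or> n = 4 \<or> n = 5" using that by linarith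
    then show ?thesis
      using pairing_harm_re[of w] assms
      by (elim disjE) (simp_all add: w_def s1_def s2_def t1_def t2_def field_simps)
  qed
  then show ?thesis by blast
qed

text \<open>
The conditions with \<open>n = 1, 3\<close> make the weights even in \<open>k\<close>, and those with \<open>n = 0, 2, 4\<close> leave one of the four
remaining weights free.
\<close>

lemma harmonic_annihilator:
  assumes "\<And>n. n \<le> 4 \<Longrightarrow> stencil_pairing w (harm_re n) = 0"
  shows "w (-1) (-1) = w 1 (-1) \<and> w 1 0 = 2 * w 1 (-1) \<and> w (-1) 0 = 2 * w 1 (-1)
    \<and> w 0 (-1) = 4 * w 1 (-1) \<and> w 0 0 = -10 * w 1 (-1)"
proof -
  have "stencil_pairing w (harm_re 0) = 0" "stencil_pairing w (harm_re 1) = 0"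
    "stencil_pairing w (harm_re 2) = 0" "stencil_pairing w (harm_re 3) = 0"
    "stencil_pairing w (harm_re 4) = 0"
    by (simp_all add: assms)
  note eqs = pairing_harm_re(1-5)[of w, unfolded this]
  have "w 1 (-1) - w (-1) (-1) = 0"
    using eqs(2,4) by argo
  moreover from this have "w 1 0 - w (-1) 0 = 0"
    using eqs(2) by argo
  moreover have "w 1 0 + w (-1) 0 = w 0 (-1)"
    using eqs(3) by argo
  ultimately show ?thesis
    using eqs(1,5) by auto
qed

text \<open>
Half of the compact nine-point Laplacian with weights \<open>-20, 4, 1\<close>, its upper row reflected at the boundary.
\<close>

definition base_stencil :: "int \<Rightarrow> int \<Rightarrow> real" where
  "base_stencil k l = (if l = 0 then if k = 0 then -10 else 2 else if k = 0 then 4 else 1)"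

lemma base_stencil_harmonic: "n \<le> 6 \<Longrightarrow> stencil_pairing base_stencil (harm_re n) = 0"
proof -
  assume "n \<le> 6"
  then have "n = 0 \<or> n = 1 \<or> n = 2 \<or> n = 3 \<or> n = 4 \<or> n = 5 \<or> n = 6" by linarith
  then show ?thesis
    using pairing_harm_re[of base_stencil] by (elim disjE) (simp_all add: base_stencil_def)
qed

lemma sum_Lam_diagonals:
  fixes f :: "nat \<Rightarrow> nat \<Rightarrow> 'a :: comm_monoid_add"
  shows "(\<Sum>(p, q)\<in>Lam N. f p q) = (\<Sum>s\<le>N. \<Sum>q\<le>s. f (s - q) q)"
proof -
  have "(\<Sum>(p, q)\<in>Lam N. f p q) = (\<Sum>(q, p)\<in>{(q, p). q + p \<le> N}. f p q)"
    by (rule sum.reindex_bij_witness[of _ prod.swap prod.swap]) (auto simp: Lam_def)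
  then show ?thesis by (simp add: sum.triangle_reindex_eq)
qed

text \<open>
The homogeneous part of degree \<open>n + d\<close> of the \<open>n\<close>-th kernel.  On the stencil it carries the factor
\<open>h^(n+d)\<close>, which turns the system into equations for the coefficients of single powers of \<open>h\<close>.
\<close>

definition boundary_kernel_part ::
  "real \<Rightarrow> real \<Rightarrow> (real \<Rightarrow> real \<Rightarrow> real) \<Rightarrow> (real \<Rightarrow> real) \<Rightarrow> nat \<Rightarrow> nat \<Rightarrow> nat \<Rightarrow> real \<Rightarrow> real \<Rightarrow> real" where
  "boundary_kernel_part x0 y0 a b M n d x y =
     (\<Sum>q\<le>n + d. boundary_coef x0 y0 a b M n (n + d - q) q * monomial (n + d - q) q x y)"

lemma boundary_kernel_homogeneous_parts:
  assumes "n \<le> Suc M"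
  shows "boundary_kernel x0 y0 a b M n (x * h) (y * h)
    = (\<Sum>d\<le>Suc M - n. h ^ (n + d) * boundary_kernel_part x0 y0 a b M n d x y)"
proof -
  have "boundary_kernel x0 y0 a b M n (x * h) (y * h)
      = (\<Sum>s\<le>Suc M. \<Sum>q\<le>s. boundary_coef x0 y0 a b M n (s - q) q * monomial (s - q) q (x * h) (y * h))"
    unfolding boundary_kernel_monomials[OF assms] by (rule sum_Lam_diagonals)
  also have "\<dots> = (\<Sum>s\<le>Suc M. h ^ s * (\<Sum>q\<le>s. boundary_coef x0 y0 a b M n (s - q) q * monomial (s - q) q x y))"
    unfolding sum_distrib_left
    by (intro sum.cong refl)
       (auto simp: monomial_def power_mult_distrib power_add[symmetric] mult_ac)
  also have "\<dots> = (\<Sum>s\<in>{n..Suc M}. h ^ s * (\<Sum>q\<le>s. boundary_coef x0 y0 a b M n (s - q) q * monomial (s - q) q x y))"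
    by (rule sum.mono_neutral_right) (auto intro!: sum.neutral simp: boundary_coef_low)
  also have "\<dots> = (\<Sum>d\<le>Suc M - n. h ^ (n + d) * boundary_kernel_part x0 y0 a b M n d x y)"
    unfolding boundary_kernel_part_def using assms
    by (intro sum.reindex_bij_witness[of _ "\<lambda>d. n + d" "\<lambda>s. s - n"]) auto
  finally show ?thesis .
qed

lemma boundary_kernel_part_leading: "boundary_kernel_part x0 y0 a b M n 0 = harm_re n"
  by (intro ext) (auto simp: boundary_kernel_part_def harm_re_def boundary_coef_leading intro!: sum.cong)

text \<open>
The base stencil is even in \<open>x\<close>.  For odd \<open>n\<close> it therefore only sees the coefficients with even \<open>q\<close>,
which are multiples of \<open>a\<^sub>x / a\<close>.  The resulting factors \<open>-3, 0, 2\<close> satisfy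
\<open>2 * (-3) - 5 * 0 + 3 * 2 = 0\<close>, the solvability condition of the interpolation problem.
\<close>

lemma boundary_kernel_part_subleading_pairing:
  assumes a: "smooth_upto x0 y0 a" and a0: "a x0 y0 \<noteq> 0"
    and n: "n \<in> {1, 3, 5}" "n \<le> M"
  shows "fact n * stencil_pairing base_stencil (boundary_kernel_part x0 y0 a b M n 1)
    = pd y0 1 0 a x0 y0 / a x0 y0 * (if n = 1 then -3 else if n = 3 then 0 else 2)"
proof -
  define A B where "A = pd y0 1 0 a x0 y0 / a x0 y0" and "B = pd y0 0 1 a x0 y0 / a x0 y0"
  let ?e = "\<lambda>n x y. \<Sum>q\<le>n + 1. (-1) ^ (q div 2) *
      (if even q then A * real (q div 2) else - B * real (q div 2) - b x0) * monomial (n + 1 - q) q x y"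
  have "boundary_kernel_part x0 y0 a b M n 1 = ?e n"
    unfolding boundary_kernel_part_def A_def B_def
    using n by (intro ext sum.cong refl) (subst boundary_coef_subleading[OF a a0], auto)
  moreover have "fact 1 * stencil_pairing base_stencil (?e 1) = A * - 3"
    "fact 3 * stencil_pairing base_stencil (?e 3) = A * 0"
    "fact 5 * stencil_pairing base_stencil (?e 5) = A * 2"
    by (simp_all add: harm_values base_stencil_def)
  ultimately show ?thesis
    unfolding A_def[symmetric] using n(1) by (elim insertE emptyE) simp_all
qed

text \<open>
The coefficient of \<open>h^(n+s)\<close> in the \<open>n\<close>-th residual involves the weights of \<open>h^s\<close> only through the leading part of
the kernel, so they are found by harmonic interpolation, with data that depend on the weights found before.
\<close>

lemma stencil_recursion:
  assumes a: "smooth_upto x0 y0 a" and a0: "a x0 y0 \<noteq> 0" and S: "S \<le> 6"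
  shows "\<exists>c. (\<forall>k l. c k l 0 = base_stencil k l) \<and> (\<forall>s\<le>S. \<forall>n\<le>6 - s.
    (\<Sum>i\<le>s. stencil_pairing (\<lambda>k l. c k l i) (boundary_kernel_part x0 y0 a b 5 n (s - i))) = 0)"
  using S
proof (induction S)
  case 0
  show ?case
    by (rule exI[of _ "\<lambda>k l i. base_stencil k l"])
       (simp add: boundary_kernel_part_leading base_stencil_harmonic)
next
  case (Suc S)
  from Suc.IH[OF Suc_leD[OF Suc.prems]] obtain c where c0: "\<And>k l. c k l 0 = base_stencil k l"
    and c: "\<And>s n. s \<le> S \<Longrightarrow> n \<le> 6 - s \<Longrightarrow>
      (\<Sum>i\<le>s. stencil_pairing (\<lambda>k l. c k l i) (boundary_kernel_part x0 y0 a b 5 n (s - i))) = 0"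
    by blast
  let ?res = "\<lambda>n. \<Sum>i\<le>S. stencil_pairing (\<lambda>k l. c k l i) (boundary_kernel_part x0 y0 a b 5 n (Suc S - i))"
  \<comment> \<open>At the powers \<open>h^s\<close> with \<open>s = Suc S \<ge> 2\<close> there is no equation for \<open>n = 5\<close>; its datum is chosen so as to satisfy
     the solvability condition.\<close>
  define r where "r n = (if S > 0 \<and> n = 5 then (30 * - ?res 3 - 2 * - ?res 1) / 360 else - ?res n)" for n
  have "2 * r 1 - 30 * r 3 + 360 * r 5 = 0"
  proof (cases "S = 0")
    case True
    have "?res n = stencil_pairing base_stencil (boundary_kernel_part x0 y0 a b 5 n 1)" for n
      using True by (simp add: c0)
    then show ?thesis
      using boundary_kernel_part_subleading_pairing[OF a a0, of 1 5 b]
        boundary_kernel_part_subleading_pairing[OF a a0, of 3 5 b]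
        boundary_kernel_part_subleading_pairing[OF a a0, of 5 5 b] True
      by (simp add: r_def fact_numeral)
  next
    case False
    have "2 * - X - 30 * - Y + 360 * ((30 * - Y - 2 * - X) / 360) = 0" for X Y :: real
      by (simp add: field_simps)
    from this[of "?res 1" "?res 3"] show ?thesis
      using False unfolding r_def by simp
  qed
  from harmonic_interpolation[OF this] obtain w where
    w: "\<And>n. n \<le> 5 \<Longrightarrow> stencil_pairing w (harm_re n) = r n" by blast
  define c' where "c' k l i = (if i = Suc S then w k l else c k l i)" for k l i
  have "(\<Sum>i\<le>s. stencil_pairing (\<lambda>k l. c' k l i) (boundary_kernel_part x0 y0 a b 5 n (s - i))) = 0"
    if s: "s \<le> Suc S" and n: "n \<le> 6 - s" for s n
  proof (cases "s = Suc S")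
    case True
    have "(\<Sum>i\<le>s. stencil_pairing (\<lambda>k l. c' k l i) (boundary_kernel_part x0 y0 a b 5 n (s - i)))
        = ?res n + stencil_pairing w (harm_re n)"
      using True by (simp add: c'_def boundary_kernel_part_leading)
    also have "n \<le> 5" "S > 0 \<Longrightarrow> n \<noteq> 5" using True n by auto
    then have "stencil_pairing w (harm_re n) = - ?res n"
      by (auto simp: w r_def)
    finally show ?thesis by simp
  next
    case False
    then have "(\<Sum>i\<le>s. stencil_pairing (\<lambda>k l. c' k l i) (boundary_kernel_part x0 y0 a b 5 n (s - i)))
        = (\<Sum>i\<le>s. stencil_pairing (\<lambda>k l. c k l i) (boundary_kernel_part x0 y0 a b 5 n (s - i)))"
      using s by (intro sum.cong) (auto simp: c'_def)
    then show ?thesis using c[of s n] s n False by simp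
  qed
  moreover have "c' k l 0 = base_stencil k l" for k l by (simp add: c'_def c0)
  ultimately show ?case by blast
qed

lemma poly_sum_monom:
  fixes h :: "'a :: comm_semiring_1"
  shows "poly (\<Sum>i\<le>N. monom (c i) i) h = (\<Sum>i\<le>N. c i * h ^ i)"
  by (simp add: poly_sum poly_monom)

text \<open>
The powers of \<open>h\<close> up to the sixth cancel by the choice of the weights, and the products of higher degree are
\<open>O(h^7)\<close>.
\<close>

lemma order_six_attainable:
  assumes a: "smooth_upto x0 y0 a" and a0: "a x0 y0 \<noteq> 0" and b: "smooth_at x0 b"
  shows "\<exists>C F Cf K Cg. has_accuracy_order x0 y0 a b C F Cf K Cg 6"
proof -
  obtain c where c0: "\<forall>k l. c k l 0 = base_stencil k l"
    and c: "\<forall>s\<le>6. \<forall>n\<le>6 - s.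
      (\<Sum>i\<le>s. stencil_pairing (\<lambda>k l. c k l i) (boundary_kernel_part x0 y0 a b 5 n (s - i))) = 0"
    using stencil_recursion[OF a a0 order_refl, of b] by (elim exE conjE)
  define C where "C k l = (\<Sum>i\<le>6. monom (c k l i) i)" for k l
  have C: "nontrivial C"
    unfolding nontrivial_def
  proof (intro bexI[of _ 0])
    show "poly (C 0 0) 0 \<noteq> 0"
      by (simp add: C_def poly_sum_monom power_0_left c0 base_stencil_def if_distrib cong: if_cong)
  qed auto
  have sys: "(\<lambda>h. stencil_sum C (boundary_kernel x0 y0 a b 5 n) h) \<in> O[at_right 0](\<lambda>h. h ^ (5 + 2))"
    if n: "n \<le> Suc 5" for n
  proof -
    define e where "e i d = stencil_pairing (\<lambda>k l. c k l i) (boundary_kernel_part x0 y0 a b 5 n d)" for i d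
    \<comment> \<open>Pairs \<open>(i, d)\<close> in \<open>?L\<close> contribute the powers up to \<open>h^6\<close>; they are grouped by \<open>s = i + d\<close>.\<close>
    let ?P = "{..6} \<times> {..6 - n}" and ?L = "{(i, d). i + d \<le> 6 - n}"
    have "stencil_sum C (boundary_kernel x0 y0 a b 5 n) h
        = (\<Sum>(i, d)\<in>?P - ?L. h ^ (n + i + d) * e i d)" for h
    proof -
      have "stencil_sum C (boundary_kernel x0 y0 a b 5 n) h = (\<Sum>(i, d)\<in>?P. h ^ (n + i + d) * e i d)"
        unfolding stencil_sum_pairing C_def poly_sum_monom boundary_kernel_homogeneous_parts[OF n]
          e_def sum.cartesian_product[symmetric]
        by (simp add: stencil_pairing_points sum_product sum.distrib[symmetric] distrib_left
            power_add mult_ac)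
      also have "\<dots> = (\<Sum>(i, d)\<in>?P - ?L. h ^ (n + i + d) * e i d)
          + (\<Sum>(i, d)\<in>?L. h ^ (n + i + d) * e i d)"
        by (rule sum.subset_diff) auto
      also have "(\<Sum>(i, d)\<in>?L. h ^ (n + i + d) * e i d)
          = (\<Sum>s\<le>6 - n. h ^ (n + s) * (\<Sum>i\<le>s. e i (s - i)))"
        by (simp add: sum.triangle_reindex_eq sum_distrib_left)
      also have "\<dots> = 0"
        unfolding e_def using n by (intro sum.neutral) (auto simp: c)
      finally show ?thesis by simp
    qed
    moreover have "(\<lambda>h. \<Sum>(i, d)\<in>?P - ?L. h ^ (n + i + d) * e i d) \<in> O[at_right 0](\<lambda>h. h ^ 7)"
    proof (rule big_sum_in_bigo)
      fix z assume "z \<in> ?P - ?L"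
      then obtain i d where z: "z = (i, d)" "7 \<le> n + i + d" using n by (cases z) auto
      have "(\<lambda>h::real. h ^ (n + i + d)) \<in> O[at_right 0](\<lambda>h. h ^ 7)"
      proof (rule landau_o.big_mono)
        show "eventually (\<lambda>h::real. norm (h ^ (n + i + d)) \<le> norm (h ^ 7)) (at_right 0)"
          unfolding eventually_at_right_field using z(2)
          by (intro exI[of _ 1]) (auto intro: power_decreasing simp: power_abs[symmetric])
      qed
      then show "(\<lambda>h. case z of (i, d) \<Rightarrow> h ^ (n + i + d) * e i d) \<in> O[at_right 0](\<lambda>h. h ^ 7)"
        by (simp add: z(1) landau_o.big.mult_in_1 mult.commute landau_o.big.cmult_in_iff')
    qed
    ultimately show ?thesis by simp
  qed
  have "has_accuracy_order x0 y0 a b C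
      (Lam (5 - 1)) (\<lambda>m n h. stencil_sum C (QH x0 y0 a 5 m n) h)
      {0..5} (\<lambda>n h. stencil_sum C (GH x0 y0 a 5 n 1) h) (5 + 1)"
    by (rule scheme_accuracy[OF a a0 b C _ sys]) simp_all
  then have "has_accuracy_order x0 y0 a b C
      (Lam (5 - 1)) (\<lambda>m n h. stencil_sum C (QH x0 y0 a 5 m n) h)
      {0..5} (\<lambda>n h. stencil_sum C (GH x0 y0 a 5 n 1) h) 6"
    by simp
  then show ?thesis by (intro exI)
qed

section \<open>Order seven is not attainable\<close>

lemma higher_deriv_const: "(deriv ^^ n) (\<lambda>_. c) = (\<lambda>_. if n = 0 then c else 0)" for c :: real
  by (induction n) auto

lemma smooth_at_const: "smooth_at x0 (\<lambda>_. c)"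
  unfolding smooth_at_def by (intro exI[of _ 1]) (simp add: higher_deriv_const)

lemma jet_mult_one:
  assumes "\<And>i j. \<alpha> i j = (if i = 0 \<and> j = 0 then 1 else 0)"
  shows "jet_mult \<alpha> \<omega> m n = \<omega> m n"
proof -
  have "(\<Sum>(i, j)\<in>{..m} \<times> {..n} - {(m, n)}.
      real (m choose i) * real (n choose j) * \<alpha> (m - i) (n - j) * \<omega> i j) = 0"
    by (intro sum.neutral) (auto simp: assms split: if_splits)
  then show ?thesis by (simp add: jet_mult_split assms)
qed

lemma bigo_cancel_power:
  fixes f g :: "real \<Rightarrow> real"
  assumes "(\<lambda>h. h ^ n * f h) \<in> O[at_right 0](\<lambda>h. h ^ n * g h)"
  shows "f \<in> O[at_right 0](g)"
proof (rule iffD1[OF landau_o.big.mult_cancel_left assms])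
  show "(\<lambda>h::real. h ^ n) \<in> \<Theta>[at_right 0](\<lambda>h. h ^ n)" by simp
  show "eventually (\<lambda>h::real. h ^ n \<noteq> 0) (at_right 0)"
    unfolding eventually_at_filter by simp
qed

lemma poly_bigo_power_coeff:
  fixes P :: "real poly"
  assumes "(\<lambda>h. poly P h) \<in> O[at_right 0](\<lambda>h. h ^ m)" "i < m"
  shows "coeff P i = 0"
  using assms
proof (induction m arbitrary: P i)
  case 0
  from 0(2) show ?case by simp
next
  case (Suc m)
  have "((\<lambda>h::real. h ^ Suc m) \<longlongrightarrow> 0) (at_right 0)"
    by (auto intro!: tendsto_eq_intros)
  from tendsto_mult_right_zero[OF tendsto_norm_zero[OF this]]
  have lim: "((\<lambda>h::real. c * norm (h ^ Suc m)) \<longlongrightarrow> 0) (at_right 0)" for c :: real .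
  obtain c where "eventually (\<lambda>h. norm (poly P h) \<le> c * norm (h ^ Suc m)) (at_right 0)"
    by (rule landau_o.bigE[OF Suc.prems(1)])
  then have "((\<lambda>h. poly P h) \<longlongrightarrow> 0) (at_right 0)"
    by (rule Lim_null_comparison[OF _ lim])
  moreover have "((\<lambda>h. poly P h) \<longlongrightarrow> poly P 0) (at_right 0)"
    by (auto intro!: tendsto_eq_intros)
  ultimately have P0: "poly P 0 = 0"
    using tendsto_unique trivial_limit_at_right_real by blast
  obtain a Q where P: "P = pCons a Q" by (cases P)
  have a: "a = 0" using P0 by (simp add: P)
  have "(\<lambda>h. poly Q h) \<in> O[at_right 0](\<lambda>h. h ^ m)"
    by (rule bigo_cancel_power[where n = 1]) (use Suc.prems(1) in \<open>simp add: P a\<close>)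
  then show ?case
    using Suc.IH[of Q] Suc.prems(2) by (cases i) (auto simp: P a)
qed

text \<open>
\<open>Re z^n / n! - Im z^(n+1) / (n + 1)!\<close>, where \<open>z\<close> is measured from the base point: the harmonic function with
\<open>u = x^n / n!\<close> and \<open>u\<^sub>y = - x^n / n!\<close> on the boundary, so that \<open>u\<^sub>y + u = 0\<close> there.
\<close>

definition robin_poly :: "real \<Rightarrow> real \<Rightarrow> nat \<Rightarrow> real \<Rightarrow> real \<Rightarrow> real" where
  "robin_poly x0 y0 n = jet_poly x0 y0 (Suc n) (\<lambda>p q. (-1) ^ (q div 2) *
     (if even q then if p + q = n then 1 else 0 else if p + q = Suc n then -1 else 0))"

lemma pd_robin_poly: "pd y0 p q (robin_poly x0 y0 n) x0 y0 = (-1) ^ (q div 2) *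
     (if even q then if p + q = n then 1 else 0 else if p + q = Suc n then -1 else 0)"
  by (simp add: robin_poly_def pd_jet_poly)

lemma smooth_upto_robin_poly: "smooth_upto x0 y0 (robin_poly x0 y0 n)"
  by (simp add: robin_poly_def jet_poly_smooth_upto)

lemma robin_poly_source:
  "pd y0 i j (source y0 (\<lambda>_ _. 1) (robin_poly x0 y0 n)) x0 y0 = 0"
proof -
  note one = smooth_upto_fun_of_x[OF smooth_at_const[of x0 1], of y0]
  show ?thesis
    unfolding pd_source[OF one(1) smooth_upto_robin_poly] source_jet_def
    by (subst (1 2) jet_mult_one) (auto simp: one(2) higher_deriv_const pd_robin_poly)
qed

lemma robin_poly_boundary:
  "(deriv ^^ i) (boundary_data y0 (\<lambda>_. 1) (robin_poly x0 y0 n)) x0 = 0"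
proof -
  have "(\<Sum>j\<le>i. real (i choose j) * ((deriv ^^ (i - j)) (\<lambda>_. 1) x0 * pd y0 j 0 (robin_poly x0 y0 n) x0 y0))
      = (\<Sum>j\<le>i. if j = i then pd y0 i 0 (robin_poly x0 y0 n) x0 y0 else 0)"
    by (intro sum.cong) (auto simp: higher_deriv_const)
  then show ?thesis
    unfolding deriv_boundary_data[OF smooth_at_const smooth_upto_robin_poly]
    by (simp add: pd_robin_poly)
qed

lemma robin_poly_scaled:
  "robin_poly x0 y0 n (x0 + x * h) (y0 + y * h) = h ^ n * (harm_re n x y - h * harm_im (Suc n) x y)"
proof -
  let ?c = "\<lambda>p q. (-1) ^ (q div 2) *
     (if even q then if p + q = n then 1 else 0 else if p + q = Suc n then -1 else (0::real))"
  have "robin_poly x0 y0 n (x0 + x * h) (y0 + y * h)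
      = (\<Sum>s\<le>Suc n. \<Sum>q\<le>s. ?c (s - q) q * monomial (s - q) q (x * h) (y * h))"
    unfolding robin_poly_def jet_poly_def by (simp add: sum_Lam_diagonals)
  also have "\<dots> = (\<Sum>s\<in>{n, Suc n}. \<Sum>q\<le>s. ?c (s - q) q * monomial (s - q) q (x * h) (y * h))"
    by (rule sum.mono_neutral_right) (auto intro!: sum.neutral)
  also have "\<dots> = (\<Sum>q\<le>n. ?c (n - q) q * monomial (n - q) q (x * h) (y * h))
      + (\<Sum>q\<le>Suc n. ?c (Suc n - q) q * monomial (Suc n - q) q (x * h) (y * h))"
    by simp
  also have "(\<Sum>q\<le>n. ?c (n - q) q * monomial (n - q) q (x * h) (y * h)) = h ^ n * harm_re n x y"
    unfolding harm_re_def sum_distrib_left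
    by (intro sum.cong refl)
       (auto simp: monomial_def power_mult_distrib power_add[symmetric] mult_ac)
  also have "(\<Sum>q\<le>Suc n. ?c (Suc n - q) q * monomial (Suc n - q) q (x * h) (y * h))
      = - (h ^ Suc n * harm_im (Suc n) x y)"
    unfolding harm_im_def sum_distrib_left sum_negf[symmetric]
    by (intro sum.cong refl)
       (auto simp: monomial_def power_mult_distrib power_add[symmetric] mult_ac simp del: power_Suc)
  finally show ?thesis by (simp add: algebra_simps)
qed

text \<open>
On the test polynomials the right-hand side of any scheme vanishes, whatever its coefficients are.  The stencil
sum is \<open>h^n\<close> times a polynomial in \<open>h\<close>; order seven makes its two lowest coefficients vanish
for every \<open>n \<le> 6\<close>.
\<close>

lemma accuracy_order_le_six:
  assumes "has_accuracy_order x0 y0 (\<lambda>_ _. 1) (\<lambda>_. 1) C F Cf K Cg p"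
  shows "p \<le> 6"
proof (rule ccontr)
  assume "\<not> p \<le> 6"
  then have p: "8 \<le> p + 1" by simp
  define w v where "w k l = coeff (C k l) 0" and "v k l = coeff (C k l) 1" for k l
  have coeffs: "stencil_pairing w (harm_re n) = 0"
      "stencil_pairing v (harm_re n) = stencil_pairing w (harm_im (Suc n))" if n: "n \<le> 6" for n
  proof -
    define Z where "Z = (\<Sum>k\<in>{-1..1}. \<Sum>l\<in>{-1..0}.
        C k l * [: harm_re n (of_int k) (of_int l), - harm_im (Suc n) (of_int k) (of_int l) :])"
    have "stencil_sum C (\<lambda>x y. robin_poly x0 y0 n (x0 + x) (y0 + y)) h = h ^ n * poly Z h" for h
      unfolding stencil_sum_def Z_def robin_poly_scaled
      by (simp add: poly_sum sum_distrib_left algebra_simps)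
    then have "(\<lambda>h. h ^ n * poly Z h) \<in> O[at_right 0](\<lambda>h. h ^ (p + 1))"
      using assms smooth_upto_robin_poly[of x0 y0 n] unfolding has_accuracy_order_def
      by (auto simp: robin_poly_source robin_poly_boundary split_beta)
    also have "(\<lambda>h::real. h ^ (p + 1)) \<in> O[at_right 0](\<lambda>h. h ^ (n + 2))"
    proof (rule landau_o.big_mono)
      show "eventually (\<lambda>h::real. norm (h ^ (p + 1)) \<le> norm (h ^ (n + 2))) (at_right 0)"
        unfolding eventually_at_right_field
      proof (intro exI[of _ 1] conjI allI impI)
        fix h :: real assume "0 < h" "h < 1"
        then show "norm (h ^ (p + 1)) \<le> norm (h ^ (n + 2))"
          unfolding norm_power using p n by (intro power_decreasing) auto
      qed simp
    qed
    also have "(\<lambda>h::real. h ^ (n + 2)) = (\<lambda>h. h ^ n * h ^ 2)"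
      by (simp add: power2_eq_square mult_ac)
    finally have "(\<lambda>h. poly Z h) \<in> O[at_right 0](\<lambda>h. h ^ 2)"
      by (rule bigo_cancel_power)
    then have "coeff Z 0 = 0" "coeff Z 1 = 0"
      using poly_bigo_power_coeff[of Z 2] by auto
    moreover have "coeff Z 0 = stencil_pairing w (harm_re n)"
      by (simp add: Z_def coeff_sum w_def stencil_pairing_def mult.commute)
    moreover have "coeff Z 1 = stencil_pairing v (harm_re n) - stencil_pairing w (harm_im (Suc n))"
      by (simp add: Z_def coeff_sum w_def v_def stencil_pairing_def sum_subtractf[symmetric] mult.commute
          coeff_pCons)
    ultimately show "stencil_pairing w (harm_re n) = 0"
      "stencil_pairing v (harm_re n) = stencil_pairing w (harm_im (Suc n))"
      by simp_all
  qed
  let ?t = "w 1 (-1)"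
  have w: "w (-1) (-1) = ?t \<and> w 1 0 = 2 * ?t \<and> w (-1) 0 = 2 * ?t \<and> w 0 (-1) = 4 * ?t \<and> w 0 0 = -10 * ?t"
    by (rule harmonic_annihilator) (simp add: coeffs(1))
  have "stencil_pairing v (harm_re 2) = stencil_pairing w (harm_im 3)"
    "stencil_pairing v (harm_re 6) = stencil_pairing w (harm_im 7)"
    using coeffs(2)[of 2] coeffs(2)[of 6] by simp_all
  then have t: "?t = 0"
    using pairing_harm_im[of w] pairing_harm_re(3,7)[of v] w by argo
  have "w k l = 0" if "k \<in> {-1..1}" "l \<in> {-1..0}" for k l
  proof -
    have "k = -1 \<or> k = 0 \<or> k = 1" "l = -1 \<or> l = 0" using that by auto
    then show ?thesis using w t by (elim disjE) simp_all
  qed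
  then have "\<not> nontrivial C"
    by (auto simp: nontrivial_def w_def poly_0_coeff_0)
  moreover have "nontrivial C" using assms by (simp add: has_accuracy_order_def)
  ultimately show False ..
qed

lemma positive_near_base: "positive_near x0 y0 a \<Longrightarrow> a x0 y0 \<noteq> 0"
  by (force simp: positive_near_def dest: half_nbhd_base[of _ x0 y0])

theorem theorem2p4:
  fixes l1 l2 l3 l4 xi yN :: real
  assumes "l1 < l2" and "l3 < l4"
    and "(xi, yN) \<in> {l1<..<l2} \<times> {l4}"
  shows "(\<forall>(a :: real \<Rightarrow> real \<Rightarrow> real) (\<beta> :: real \<Rightarrow> real)
            (c :: int \<Rightarrow> int \<Rightarrow> nat \<Rightarrow> real) (C :: int \<Rightarrow> int \<Rightarrow> real poly).
            smooth_upto xi yN a \<and> positive_near xi yN a \<and> smooth_at xi \<beta> \<and>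
            C = (\<lambda>k l. \<Sum>i = 0..6. monom (c k l i) i) \<and>
            nontrivial C \<and>
            (\<forall>n\<in>{0..6}.
               (\<lambda>h. stencil_sum C
                      (\<lambda>x y. GH xi yN a 5 n 0 x y -
                         (\<Sum>i = n..5. real (i choose n) * (deriv ^^ (i - n)) \<beta> xi *
                            GH xi yN a 5 i 1 x y * (1 - (if n = 6 then 1 else 0)))) h)
                 \<in> O[at_right 0](\<lambda>h. h ^ 7))
            \<longrightarrow>
            has_accuracy_order xi yN a \<beta> C
              (Lam 4) (\<lambda>m n h. stencil_sum C (QH xi yN a 5 m n) h)
              {0..5} (\<lambda>n h. stencil_sum C (GH xi yN a 5 n 1) h)
              6)
         \<and> max_accuracy_order xi yN 6"
proof (intro conjI allI impI)
  fix a \<beta> c and C :: "int \<Rightarrow> int \<Rightarrow> real poly"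
  assume *: "smooth_upto xi yN a \<and> positive_near xi yN a \<and> smooth_at xi \<beta> \<and>
            C = (\<lambda>k l. \<Sum>i = 0..6. monom (c k l i) i) \<and>
            nontrivial C \<and>
            (\<forall>n\<in>{0..6}.
               (\<lambda>h. stencil_sum C
                      (\<lambda>x y. GH xi yN a 5 n 0 x y -
                         (\<Sum>i = n..5. real (i choose n) * (deriv ^^ (i - n)) \<beta> xi *
                            GH xi yN a 5 i 1 x y * (1 - (if n = 6 then 1 else 0)))) h)
                 \<in> O[at_right 0](\<lambda>h. h ^ 7))"
  have "(\<lambda>x y. GH xi yN a 5 n 0 x y -
      (\<Sum>i = n..5. real (i choose n) * (deriv ^^ (i - n)) \<beta> xi *
         GH xi yN a 5 i 1 x y * (1 - (if n = 6 then 1 else 0)))) = boundary_kernel xi yN a \<beta> 5 n"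
    for n by (intro ext) (simp add: boundary_kernel_def)
  moreover from * have "\<forall>n\<in>{0..6}.
               (\<lambda>h. stencil_sum C
                      (\<lambda>x y. GH xi yN a 5 n 0 x y -
                         (\<Sum>i = n..5. real (i choose n) * (deriv ^^ (i - n)) \<beta> xi *
                            GH xi yN a 5 i 1 x y * (1 - (if n = 6 then 1 else 0)))) h)
                 \<in> O[at_right 0](\<lambda>h. h ^ 7)" by blast
  ultimately have sys: "(\<lambda>h. stencil_sum C (boundary_kernel xi yN a \<beta> 5 n) h) \<in> O[at_right 0](\<lambda>h. h ^ (5 + 2))"
    if "n \<le> Suc 5" for n
    using that by simp
  from * have "smooth_upto xi yN a" "positive_near xi yN a" "smooth_at xi \<beta>" "nontrivial C"
    by blast+
  then show "has_accuracy_order xi yN a \<beta> C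
              (Lam 4) (\<lambda>m n h. stencil_sum C (QH xi yN a 5 m n) h)
              {0..5} (\<lambda>n h. stencil_sum C (GH xi yN a 5 n 1) h) 6"
    using scheme_accuracy[of xi yN a \<beta> C 5] sys positive_near_base by simp
next
  have one: "smooth_upto xi yN (\<lambda>_ _. 1)" "positive_near xi yN (\<lambda>_ _. 1)" "smooth_at xi (\<lambda>_. 1)"
    using smooth_upto_fun_of_x(1)[OF smooth_at_const] smooth_at_const
    by (auto simp: positive_near_def intro: exI[of _ 1])
  show "max_accuracy_order xi yN 6"
    unfolding max_accuracy_order_def attainable_order_def
  proof (intro conjI allI impI)
    fix a b assume "smooth_upto xi yN a \<and> positive_near xi yN a \<and> smooth_at xi b"
    then show "\<exists>C F Cf K Cg. has_accuracy_order xi yN a b C F Cf K Cg 6"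
      using order_six_attainable positive_near_base by blast
  next
    fix q assume "\<forall>a b. smooth_upto xi yN a \<and> positive_near xi yN a \<and> smooth_at xi b \<longrightarrow>
        (\<exists>C F Cf K Cg. has_accuracy_order xi yN a b C F Cf K Cg q)"
    then show "q \<le> 6" using one accuracy_order_le_six by blast
  qed
qed

end
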